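(* Let $p>0$, let $\mathbb{T}$ be a $p$-periodic time scale, let $t_0\in\mathbb{T}$, and let $M$ be a constant nonsingular $n\times n$ matrix. Then a solution of the time scale matrix exponential equation $e_R(t_0+p,t_0)=M$ is given by $R:\mathbb{T}\to\mathbb{C}^{n\times n}$, where $$R(t):=\lim_{s\searrow\mu(t)}\frac{M^{s/p}-I}{s}.$$ If $\mathbb{T}$ has constant graininess on the interval $[t_0,t_0+p]\cap\mathbb{T}$, then $R(t)$ is constant.
   Context: A time scale $\mathbb{T}$ is a nonempty closed subset of $\mathbb{R}$; $\sigma(t)=\inf\{s\in\mathbb{T}:s>t\}$, the graininess is $\mu(t)=\sigma(t)-t$, and $f^\Delta$ denotes the delta (Hilger) derivative. $\mathbb{T}$ is $p$-periodic if for all $t\in\mathbb{T}$: $t+p\in\mathbb{T}$ and $\mu(t)=\mu(t+p)$; it is assumed that $0\le\mu(t)\le p$. A matrix function $R$ is regressive if it is rd-continuous and $I+\mu(t)R(t)$ is invertible for all $t$. When $R$ commutes with its delta integral, i.e. $R(t)\int_s^tR(\tau)\Delta\tau=\int_s^tR(\tau)\Delta\tau\,R(t)$, $e_R(t,t_0)$ denotes the unique matrix solution of $X^\Delta=R(t)X$, $X(t_0)=I$. Real power of a nonsingular $n\times n$ matrix $M$: let $\lambda_1,\dots,\lambda_k$ be the distinct eigenvalues of $M$ with multiplicities $m_1,\dots,m_k$, let $c(\lambda)=\prod_i(\lambda-\lambda_i)^{m_i}$ be the characteristic polynomial, let the polynomials $a_i$ ($\deg a_i<m_i$) be defined by the partial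 fraction expansion $\frac1{c(\lambda)}=\sum_{i=1}^k\frac{a_i(\lambda)}{(\lambda-\lambda_i)^{m_i}}$, let $b_i(\lambda)=\prod_{j\ne i}(\lambda-\lambda_j)^{m_j}$, and $P_i(M)=a_i(M)b_i(M)$. For $r\in\mathbb{R}$, $$M^r=\sum_{i=1}^kP_i(M)\lambda_i^r\left[\sum_{j=0}^{m_i-1}\frac{\Gamma(r+1)}{j!\,\Gamma(r-j+1)}\left(\frac{M-\lambda_iI}{\lambda_i}\right)^j\right],$$ with principal values of $\lambda_i^r$ (the factor $\Gamma(r+1)/(j!\,\Gamma(r-j+1))$ is the binomial coefficient $\binom rj$). *)

theory Defs
  imports "HOL-Analysis.Analysis" "HOL-Computational_Algebra.Polynomial"
begin

section \<open>Time scales\<close>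

definition time_scale :: "real set \<Rightarrow> bool" where
  "time_scale T \<longleftrightarrow> T \<noteq> {} \<and> closed T"

text \<open>The conditionals implement the usual conventions inf {} = sup T and sup {} = inf T,
  which only matter at a maximum, respectively a minimum, of T.\<close>

definition ts_sigma :: "real set \<Rightarrow> real \<Rightarrow> real" where
  "ts_sigma T t = (if \<exists>s\<in>T. t < s then Inf {s\<in>T. t < s} else t)"

definition ts_rho :: "real set \<Rightarrow> real \<Rightarrow> real" where
  "ts_rho T t = (if \<exists>s\<in>T. s < t then Sup {s\<in>T. s < t} else t)"

definition ts_mu :: "real set \<Rightarrow> real \<Rightarrow> real" where
  "ts_mu T t = ts_sigma T t - t"

definition ts_periodic :: "real \<Rightarrow> real set \<Rightarrow> bool" where
  "ts_periodic p T \<longleftrightarrow>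
     (\<forall>t\<in>T. t + p \<in> T \<and> ts_mu T t = ts_mu T (t + p) \<and> 0 \<le> ts_mu T t \<and> ts_mu T t \<le> p)"

text \<open>The set where delta derivatives live: T without a left-scattered maximum.\<close>

definition ts_kappa :: "real set \<Rightarrow> real set" where
  "ts_kappa T = (if bdd_above T then T - {ts_rho T (Sup T)<..Sup T} else T)"

text \<open>Hilger's definition of the delta derivative.\<close>

definition has_delta_derivative ::
    "real set \<Rightarrow> (real \<Rightarrow> 'a::real_normed_vector) \<Rightarrow> 'a \<Rightarrow> real \<Rightarrow> bool" where
  "has_delta_derivative T f D t \<longleftrightarrow>
     (\<forall>\<epsilon>>0. \<exists>\<delta>>0. \<forall>s\<in>T. \<bar>s - t\<bar> < \<delta> \<longrightarrow>
        norm ((f (ts_sigma T t) - f s) - (ts_sigma T t - s) *\<^sub>R D) \<le> \<epsilon> * \<bar>ts_sigma T t - s\<bar>)"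

text \<open>The Cauchy delta integral, defined through antiderivatives.\<close>

definition delta_antiderivative ::
    "real set \<Rightarrow> (real \<Rightarrow> 'a::real_normed_vector) \<Rightarrow> (real \<Rightarrow> 'a) \<Rightarrow> bool" where
  "delta_antiderivative T F f \<longleftrightarrow> (\<forall>t\<in>ts_kappa T. has_delta_derivative T F (f t) t)"

definition delta_integral ::
    "real set \<Rightarrow> (real \<Rightarrow> 'a::real_normed_vector) \<Rightarrow> real \<Rightarrow> real \<Rightarrow> 'a" where
  "delta_integral T f s t = (THE I. \<exists>F. delta_antiderivative T F f \<and> I = F t - F s)"

definition rd_continuous :: "real set \<Rightarrow> (real \<Rightarrow> 'a::real_normed_vector) \<Rightarrow> bool" where
  "rd_continuous T f \<longleftrightarrow>
     (\<forall>t\<in>T. (\<exists>s\<in>T. t < s) \<and> ts_sigma T t = t \<longrightarrow> continuous (at t within T) f) \<and>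
     (\<forall>t\<in>T. (\<exists>s\<in>T. s < t) \<and> ts_rho T t = t \<longrightarrow> (\<exists>L. (f \<longlongrightarrow> L) (at t within T \<inter> {..<t})))"

section \<open>The time scale matrix exponential\<close>

definition ts_regressive :: "real set \<Rightarrow> (real \<Rightarrow> complex^'n^'n) \<Rightarrow> bool" where
  "ts_regressive T R \<longleftrightarrow>
     rd_continuous T R \<and> (\<forall>t\<in>T. invertible (mat 1 + ts_mu T t *\<^sub>R R t))"

definition commutes_with_delta_integral :: "real set \<Rightarrow> (real \<Rightarrow> complex^'n^'n) \<Rightarrow> bool" where
  "commutes_with_delta_integral T R \<longleftrightarrow>
     (\<forall>s\<in>T. \<forall>t\<in>T. R t ** delta_integral T R s t = delta_integral T R s t ** R t)"

text \<open>Solutions are functions on T; the value 0 outside T is only a normalisation, which makes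
  uniqueness of the solution expressible for total functions.\<close>

definition ts_fundamental_solution ::
    "real set \<Rightarrow> (real \<Rightarrow> complex^'n^'n) \<Rightarrow> real \<Rightarrow> (real \<Rightarrow> complex^'n^'n) \<Rightarrow> bool" where
  "ts_fundamental_solution T R t0 X \<longleftrightarrow>
     X t0 = mat 1 \<and>
     (\<forall>t\<in>ts_kappa T. has_delta_derivative T X (R t ** X t) t) \<and>
     (\<forall>t. t \<notin> T \<longrightarrow> X t = 0)"

definition ts_mat_exp ::
    "real set \<Rightarrow> (real \<Rightarrow> complex^'n^'n) \<Rightarrow> real \<Rightarrow> real \<Rightarrow> complex^'n^'n" where
  "ts_mat_exp T R t t0 = (THE X. ts_fundamental_solution T R t0 X) t"

section \<open>Real powers of a nonsingular matrix\<close>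

text \<open>The product on \<^typ>\<open>complex^'n^'n\<close> is \<open>**\<close>; the type class operations \<open>*\<close> and \<open>^\<close>
  act entrywise. Multiplication by a complex scalar c is written \<open>mat c ** A\<close>.\<close>

definition mat_power :: "complex^'n^'n \<Rightarrow> nat \<Rightarrow> complex^'n^'n" where
  "mat_power A k = (((**) A) ^^ k) (mat 1)"

definition mat_poly :: "complex poly \<Rightarrow> complex^'n^'n \<Rightarrow> complex^'n^'n" where
  "mat_poly q A = (\<Sum>k\<le>degree q. mat (coeff q k) ** mat_power A k)"

definition char_polynomial :: "complex^'n^'n \<Rightarrow> complex poly" where
  "char_polynomial M = det ((\<chi> i j. (if i = j then [:0, 1:] else 0) - [:M $ i $ j:]) :: complex poly^'n^'n)"

definition eigenvalues :: "complex^'n^'n \<Rightarrow> complex set" where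
  "eigenvalues M = {l. \<exists>v. v \<noteq> 0 \<and> M *v v = l *s v}"

definition alg_mult :: "complex^'n^'n \<Rightarrow> complex \<Rightarrow> nat" where
  "alg_mult M l = order l (char_polynomial M)"

text \<open>The numerators \<open>a\<^sub>i\<close> of the partial fraction expansion of the reciprocal of the
  characteristic polynomial, indexed by the eigenvalues rather than by 1, ..., k; setting them
  to 0 at all other arguments makes the family unique.\<close>

definition pf_numerators :: "complex^'n^'n \<Rightarrow> complex \<Rightarrow> complex poly" where
  "pf_numerators M = (THE a.
     (\<forall>l. l \<notin> eigenvalues M \<longrightarrow> a l = 0) \<and>
     (\<forall>l\<in>eigenvalues M. degree (a l) < alg_mult M l) \<and>
     (\<forall>z. z \<notin> eigenvalues M \<longrightarrow>
        1 / poly (char_polynomial M) z =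
        (\<Sum>l\<in>eigenvalues M. poly (a l) z / (z - l) ^ alg_mult M l)))"

definition pf_cofactor :: "complex^'n^'n \<Rightarrow> complex \<Rightarrow> complex poly" where
  "pf_cofactor M l = (\<Prod>l'\<in>eigenvalues M - {l}. [:- l', 1:] ^ alg_mult M l')"

definition spectral_proj :: "complex^'n^'n \<Rightarrow> complex \<Rightarrow> complex^'n^'n" where
  "spectral_proj M l = mat_poly (pf_numerators M l) M ** mat_poly (pf_cofactor M l) M"

text \<open>\<open>r gchoose j\<close> is Gamma(r+1) / (j! Gamma(r-j+1)), extended to the negative integers r, where
  the Gamma quotient is only defined as a limit. For l \<noteq> 0, \<open>powr\<close> on complex numbers is the
  principal value.\<close>

definition mat_rpower :: "complex^'n^'n \<Rightarrow> real \<Rightarrow> complex^'n^'n" where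
  "mat_rpower M r =
     (\<Sum>l\<in>eigenvalues M.
        spectral_proj M l ** mat (l powr of_real r) **
        (\<Sum>j<alg_mult M l.
           mat (of_real r gchoose j) ** mat_power (mat (1 / l) ** (M - mat l)) j))"

definition exp_difference_quotient :: "real \<Rightarrow> complex^'n^'n \<Rightarrow> real \<Rightarrow> complex^'n^'n" where
  "exp_difference_quotient p M s = (mat_rpower M (s / p) - mat 1) /\<^sub>R s"

definition floquet_matrix :: "real set \<Rightarrow> real \<Rightarrow> complex^'n^'n \<Rightarrow> real \<Rightarrow> complex^'n^'n" where
  "floquet_matrix T p M t = Lim (at_right (ts_mu T t)) (exp_difference_quotient p M)"

end

theory Submission
  imports Defs "HOL-Computational_Algebra.Computational_Algebra"
    "HOL-Computational_Algebra.Field_as_Ring"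
begin

text \<open>The powers of \<open>M\<close> form a differentiable one-parameter group with value \<open>M\<close> at 1: they are
  polynomials in \<open>M\<close>, and by the Cayley--Hamilton theorem the group law may be checked modulo each
  \<open>(x - l)^m\<close>, where it is Vandermonde's identity for binomial coefficients. Hence
  \<open>V x = M\<^sup>x\<^sup>/\<^sup>p\<close> satisfies \<open>V (\<sigma> t) - V t = (V (\<mu> t) - I) V t\<close>, so that \<open>V (t - t0)\<close> solves the
  equation with \<open>R t = (V (\<mu> t) - I) / \<mu> t\<close> (and \<open>R t = V'(0)\<close> where \<open>\<mu> t = 0\<close>); the inverse group
  as an integrating factor gives uniqueness. Since \<open>R\<close> is a continuous function of the graininess,
  extending the latter to the gaps of \<open>T\<close> and integrating over the real line yields a delta
  antiderivative of \<open>R\<close>.\<close>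

section \<open>Time scales unbounded above\<close>

text \<open>The delta integral, the exponential and the partial fraction numerators are all definite
  descriptions, so nothing is known about their values until existence and uniqueness are proved.
  This is why an antiderivative of \<open>R\<close> is constructed although only commutation with
  the integral is wanted, and why so much rests on one principle: a function with zero delta
  derivative is constant. That principle yields uniqueness of the integral, commutation of the
  integral with \<open>R\<close>, and uniqueness of the solution, before \<open>t0\<close> as well
  as after it. Periodicity with \<open>p > 0\<close> makes \<open>T\<close> unbounded above, so
  \<open>ts_kappa T = T\<close> and the convention for \<open>ts_sigma\<close> at a maximum never
  enters. It is a forward condition only: \<open>t - p\<close> need not lie in \<open>T\<close>, and
  \<open>T\<close> may have a minimum. Constancy of the graininess therefore has to be carried from
  one period to all of \<open>T\<close> with some care.\<close>

lemma ts_sigma_props: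
  assumes "closed T" "\<exists>s\<in>T. x < s"
  shows "ts_sigma T x \<in> T" "x \<le> ts_sigma T x" "s \<in> T \<Longrightarrow> x < s \<Longrightarrow> ts_sigma T x \<le> s"
proof -
  let ?A = "{s\<in>T. x < s}"
  have ne: "?A \<noteq> {}" and bb: "bdd_below ?A" using assms(2) by (auto intro: bdd_belowI[of _ x])
  have eq: "ts_sigma T x = Inf ?A" using assms(2) by (simp add: ts_sigma_def)
  have "Inf ?A \<in> closure ?A" using closure_contains_Inf[OF ne bb] .
  moreover have "closure ?A \<subseteq> T" using assms(1) by (intro closure_minimal) auto
  ultimately show "ts_sigma T x \<in> T" using eq by auto
  show "x \<le> ts_sigma T x" unfolding eq using ne by (intro cInf_greatest) auto
  show "ts_sigma T x \<le> s" if "s \<in> T" "x < s" unfolding eq using that bb by (intro cInf_lower) auto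
qed

lemma ts_sigma_dense:
  assumes "\<exists>s\<in>T. x < s" "ts_sigma T x = x" "0 < d"
  obtains s where "s \<in> T" "x < s" "s < x + d"
proof -
  have ne: "{s\<in>T. x < s} \<noteq> {}" using assms(1) by auto
  have "Inf {s\<in>T. x < s} < x + d" using assms by (simp add: ts_sigma_def)
  then obtain s where "s \<in> {s\<in>T. x < s}" "s < x + d" using cInf_lessD[OF ne] by blast
  then show ?thesis using that by auto
qed

lemma unbounded_above:
  fixes T :: "real set"
  assumes "closed T" "\<forall>t\<in>T. \<exists>s\<in>T. t < s" "T \<noteq> {}"
  shows "\<exists>s\<in>T. x < s"
proof -
  have "\<not> bdd_above T"
  proof
    assume "bdd_above T"
    then have "Sup T \<in> T" "\<forall>t\<in>T. t \<le> Sup T"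
      using closed_contains_Sup[of T] assms by (auto intro: cSup_upper)
    then show False using assms(2) by force
  qed
  then show ?thesis by (meson bdd_above.I not_le)
qed

lemma ts_kappa_unbounded:
  fixes T :: "real set"
  assumes "closed T" "\<forall>t\<in>T. \<exists>s\<in>T. t < s"
  shows "ts_kappa T = T"
proof (cases "T = {}")
  case False
  have "\<not> bdd_above T"
    using unbounded_above[OF assms False] by (meson bdd_above.E not_le)
  then show ?thesis by (simp add: ts_kappa_def)
qed (simp add: ts_kappa_def)

text \<open>At a right-dense point Hilger's estimate is literally the derivative within
  \<open>T\<close>. At a right-scattered point, putting \<open>s = t\<close> forces \<open>D\<close>
  to be the slope across the gap, and what remains of the estimate is continuity. Later derivative
  rules thus become arithmetic across gaps plus ordinary calculus.\<close>

lemma has_delta_derivative_iff: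
  fixes f :: "real \<Rightarrow> 'a::real_normed_vector"
  assumes "closed T" "t \<in> T" "\<exists>s\<in>T. t < s"
  shows "has_delta_derivative T f D t \<longleftrightarrow>
    f (ts_sigma T t) - f t = ts_mu T t *\<^sub>R D \<and> continuous (at t within T) f \<and>
    (ts_sigma T t = t \<longrightarrow> (f has_vector_derivative D) (at t within T))"
proof (cases "ts_sigma T t = t")
  case True
  have "has_delta_derivative T f D t \<longleftrightarrow> (f has_vector_derivative D) (at t within T)"
    unfolding has_delta_derivative_def has_vector_derivative_def has_derivative_within_alt True
    by (simp add: bounded_linear_scaleR_left norm_minus_commute abs_minus_commute algebra_simps)
  then show ?thesis
    using True by (auto simp: ts_mu_def dest: has_vector_derivative_continuous)
next
  case False
  let ?s = "ts_sigma T t"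
  have gt: "t < ?s" using ts_sigma_props(2)[OF assms(1,3)] False by simp
  have "has_delta_derivative T f D t \<longleftrightarrow>
    f ?s - f t = ts_mu T t *\<^sub>R D \<and> continuous (at t within T) f"
  proof
    assume L: "has_delta_derivative T f D t"
    have "norm (f ?s - f t - (?s - t) *\<^sub>R D) \<le> 0"
    proof (rule field_le_epsilon)
      fix e :: real assume "0 < e"
      then have "0 < e / (?s - t)" using gt by simp
      with L obtain d where "0 < d" and
        d: "\<forall>s\<in>T. \<bar>s - t\<bar> < d \<longrightarrow>
          norm ((f ?s - f s) - (?s - s) *\<^sub>R D) \<le> e / (?s - t) * \<bar>?s - s\<bar>"
        unfolding has_delta_derivative_def by blast
      then show "norm (f ?s - f t - (?s - t) *\<^sub>R D) \<le> 0 + e"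
        using assms(2) gt by (force dest: bspec[of _ _ t])
    qed
    then have eq: "f ?s - f t = (?s - t) *\<^sub>R D" by simp
    have "(f \<longlongrightarrow> f t) (at t within T)"
    proof (rule tendsto_norm_zero_cancel[THEN LIM_zero_cancel], rule tendstoI)
      fix e :: real assume e: "0 < e"
      \<comment> \<open>Within distance 1 of \<open>t\<close> one has
        \<open>\<bar>?s - s\<bar> \<le> ?s - t + 1\<close>, so \<open>e'\<close> makes Hilger's
        error at most \<open>e / 2\<close>. The second bound in \<open>d'\<close> keeps the linear
        term below \<open>e / 2\<close>; its \<open>+ 1\<close> covers \<open>D = 0\<close>.\<close>
      define e' where "e' = e / 2 / (?s - t + 1)"
      have "0 < e'" using gt e by (simp add: e'_def)
      with L obtain d where "0 < d" and
        d: "\<And>s. s\<in>T \<Longrightarrow> \<bar>s - t\<bar> < d \<Longrightarrow>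
          norm ((f ?s - f s) - (?s - s) *\<^sub>R D) \<le> e' * \<bar>?s - s\<bar>"
        unfolding has_delta_derivative_def by blast
      define d' where "d' = min (min d 1) (e / 2 / (norm D + 1))"
      have d'0: "0 < d'" using \<open>0 < d\<close> e by (simp add: d'_def add_nonneg_pos)
      have *: "norm (f s - f t) < e" if s: "s \<in> T" "\<bar>s - t\<bar> < d'" for s
      proof -
        have "norm ((f ?s - f s) - (?s - s) *\<^sub>R D) \<le> e' * \<bar>?s - s\<bar>"
          using d s by (simp add: d'_def)
        also have "\<dots> \<le> e' * (?s - t + 1)"
          using s gt \<open>0 < e'\<close> by (intro mult_left_mono) (auto simp: d'_def)
        also have "\<dots> = e / 2" using gt by (simp add: e'_def divide_simps)
        finally have 1: "norm ((f ?s - f s) - (?s - s) *\<^sub>R D) \<le> e / 2" .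
        have "f s - f t = (s - t) *\<^sub>R D - ((f ?s - f s) - (?s - s) *\<^sub>R D)"
          using eq by (simp add: algebra_simps)
        then have "norm (f s - f t) \<le> \<bar>s - t\<bar> * norm D + norm ((f ?s - f s) - (?s - s) *\<^sub>R D)"
          by (metis norm_scaleR norm_triangle_ineq4)
        moreover have "\<bar>s - t\<bar> * norm D < e / 2"
        proof -
          have "\<bar>s - t\<bar> * norm D \<le> \<bar>s - t\<bar> * (norm D + 1)" by (simp add: mult_left_mono)
          also have "\<dots> < d' * (norm D + 1)" using s by (intro mult_strict_right_mono) (auto simp: add_nonneg_pos)
          also have "\<dots> \<le> e / 2 / (norm D + 1) * (norm D + 1)"
            by (intro mult_right_mono) (auto simp: d'_def)
          also have "\<dots> = e / 2"
            using nonzero_eq_divide_eq[THEN iffD1, OF _ refl, of "norm D + 1" "e / 2"]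
              norm_ge_zero[of D] by linarith
          finally show ?thesis .
        qed
        ultimately show ?thesis using 1 by simp
      qed
      show "\<forall>\<^sub>F s in at t within T. dist (norm (f s - f t)) 0 < e"
        unfolding eventually_at using d'0 * by (auto simp: dist_real_def)
    qed
    with eq show "f ?s - f t = ts_mu T t *\<^sub>R D \<and> continuous (at t within T) f"
      by (simp add: ts_mu_def continuous_within)
  next
    assume R: "f ?s - f t = ts_mu T t *\<^sub>R D \<and> continuous (at t within T) f"
    have lim: "((\<lambda>s. norm (f t - f s - (t - s) *\<^sub>R D)) \<longlongrightarrow> 0) (at t within T)"
    proof -
      have "((\<lambda>s. norm (f t - f s - (t - s) *\<^sub>R D)) \<longlongrightarrow> norm (f t - f t - (t - t) *\<^sub>R D)) (at t within T)"
        using R by (intro tendsto_intros) (auto simp: continuous_within)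
      then show ?thesis by simp
    qed
    show "has_delta_derivative T f D t"
      unfolding has_delta_derivative_def
    proof (intro allI impI)
      fix e :: real assume e: "0 < e"
      \<comment> \<open>Near a right-scattered \<open>t\<close> the distance
        \<open>\<bar>?s - s\<bar>\<close> stays above half the gap, so the relative tolerance
        contains a fixed absolute one, which continuity can meet.\<close>
      have "0 < e * ((?s - t) / 2)" using e gt by simp
      from tendstoD[OF lim this] obtain d where "0 < d" and
        d: "\<And>s. s\<in>T \<Longrightarrow> s \<noteq> t \<Longrightarrow> dist s t < d \<Longrightarrow> norm (f t - f s - (t - s) *\<^sub>R D) < e * ((?s - t) / 2)"
        unfolding eventually_at by auto
      have "norm ((f ?s - f s) - (?s - s) *\<^sub>R D) \<le> e * \<bar>?s - s\<bar>"
        if s: "s\<in>T" "\<bar>s - t\<bar> < min d ((?s - t) / 2)" for s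
      proof -
        have eq: "(f ?s - f s) - (?s - s) *\<^sub>R D = f t - f s - (t - s) *\<^sub>R D"
          using R by (simp add: ts_mu_def algebra_simps)
        have "\<bar>s - t\<bar> < (?s - t) / 2" using s(2) by simp
        then have "(?s - t) / 2 \<le> \<bar>?s - s\<bar>" by (simp add: abs_real_def split: if_splits)
        then have "e * ((?s - t) / 2) \<le> e * \<bar>?s - s\<bar>" using e by (intro mult_left_mono) auto
        moreover have "norm (f t - f s - (t - s) *\<^sub>R D) \<le> e * ((?s - t) / 2)"
          using d[of s] s e gt by (cases "s = t") (auto simp: dist_real_def)
        ultimately show ?thesis unfolding eq by (rule order_trans[rotated])
      qed
      then show "\<exists>\<delta>>0. \<forall>s\<in>T. \<bar>s - t\<bar> < \<delta> \<longrightarrow>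
          norm ((f ?s - f s) - (?s - s) *\<^sub>R D) \<le> e * \<bar>?s - s\<bar>"
        using \<open>0 < d\<close> gt by (intro exI[of _ "min d ((?s - t) / 2)"]) auto
    qed
  qed
  with False show ?thesis by simp
qed

lemma has_delta_derivative_cong:
  assumes "closed T" "t \<in> T" "\<exists>s\<in>T. t < s" "\<And>s. s \<in> T \<Longrightarrow> f s = g s"
  shows "has_delta_derivative T f D t \<longleftrightarrow> has_delta_derivative T g D t"
  using ts_sigma_props(1)[OF assms(1,3)] assms(4) by (simp add: has_delta_derivative_def)

lemma has_delta_derivative_bounded_linear:
  assumes "closed T" "t \<in> T" "\<exists>s\<in>T. t < s" "bounded_linear L" "has_delta_derivative T f D t"
  shows "has_delta_derivative T (\<lambda>x. L (f x)) (L D) t"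
proof -
  interpret L: bounded_linear L by fact
  show ?thesis
    using assms(5) unfolding has_delta_derivative_iff[OF assms(1-3)]
    by (auto simp: L.diff[symmetric] L.scaleR intro: L.continuous L.has_vector_derivative)
qed

lemma has_delta_derivative_diff:
  assumes "closed T" "t \<in> T" "\<exists>s\<in>T. t < s"
    "has_delta_derivative T f D t" "has_delta_derivative T g E t"
  shows "has_delta_derivative T (\<lambda>x. f x - g x) (D - E) t"
  using assms(4,5) unfolding has_delta_derivative_iff[OF assms(1-3)]
  by (auto simp: algebra_simps intro!: continuous_intros has_vector_derivative_diff)

text \<open>Induction along \<open>T\<close> by a supremum. For each slope \<open>e > 0\<close>,
  \<open>G\<close> collects the points up to which \<open>f\<close> stays in the cone
  \<open>norm (f s - f a) \<le> e * (s - a)\<close>. Its supremum belongs to \<open>G\<close> by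
  continuity, yet \<open>G\<close> can always be extended beyond it. Working with norms admits
  vector values, where no mean value theorem holds.\<close>

lemma zero_delta_derivative_constant:
  fixes f :: "real \<Rightarrow> 'a::real_normed_vector"
  assumes T: "closed T" "\<forall>t\<in>T. \<exists>s\<in>T. t < s"
    and f: "\<forall>t\<in>T. has_delta_derivative T f 0 t" and "a \<in> T" "b \<in> T"
  shows "f a = f b"
proof -
  have *: "f b = f a" if "a \<in> T" "b \<in> T" "a < b" for a b
  proof -
    have step: "f (ts_sigma T t) = f t" and cont: "continuous (at t within T) f"
      and dense: "ts_sigma T t = t \<Longrightarrow> (f has_vector_derivative 0) (at t within T)"
      if "t \<in> T" for t
      using that f T has_delta_derivative_iff[OF T(1), of t f 0] by auto
    have "norm (f b - f a) \<le> e * (b - a)" if "0 < e" for e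
    proof (rule ccontr)
      assume neg: "\<not> norm (f b - f a) \<le> e * (b - a)"
      define G where "G = {t\<in>T. a \<le> t \<and> (\<forall>s\<in>T. a \<le> s \<and> s \<le> t \<longrightarrow> norm (f s - f a) \<le> e * (s - a))}"
      have aG: "a \<in> G" using \<open>a \<in> T\<close> by (auto simp: G_def)
      have Gb: "t < b" if "t \<in> G" for t
        using that neg \<open>b \<in> T\<close> \<open>a < b\<close> by (force simp: G_def)
      then have bdd: "bdd_above G" by (auto intro!: bdd_aboveI[of _ b] less_imp_le)
      define c where "c = Sup G"
      have "c \<in> closure G" using closure_contains_Sup[of G] aG bdd by (auto simp: c_def)
      have "G \<subseteq> T" by (auto simp: G_def)
      then have cT: "c \<in> T" using \<open>c \<in> closure G\<close> T(1) closure_minimal by blast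
      have ac: "a \<le> c" using aG bdd by (auto simp: c_def intro: cSup_upper)
      have below: "norm (f s - f a) \<le> e * (s - a)" if "s \<in> T" "a \<le> s" "s < c" for s
      proof -
        have "\<exists>t\<in>G. s < t" using aG \<open>s < c\<close> by (intro less_cSupD) (auto simp: c_def)
        then obtain t where "t \<in> G" "s < t" by auto
        then show ?thesis using that by (auto simp: G_def)
      qed
      have at_c: "norm (f c - f a) \<le> e * (c - a)"
      proof (cases "c \<in> G")
        case False
        then have lim: "c islimpt G" using \<open>c \<in> closure G\<close> by (simp add: closure_def)
        then have nt: "at c within G \<noteq> bot" by (simp add: trivial_limit_within)
        have "(f \<longlongrightarrow> f c) (at c within G)"
          using cont[OF cT] \<open>G \<subseteq> T\<close> by (auto simp: continuous_within intro: tendsto_within_subset)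
        then have 1: "((\<lambda>s. norm (f s - f a)) \<longlongrightarrow> norm (f c - f a)) (at c within G)"
          by (intro tendsto_intros)
        have 2: "((\<lambda>s. e * (s - a)) \<longlongrightarrow> e * (c - a)) (at c within G)"
          by (intro tendsto_intros)
        have "\<forall>\<^sub>F s in at c within G. norm (f s - f a) \<le> e * (s - a)"
          unfolding eventually_at by (auto simp: G_def intro!: exI[of _ 1])
        then show ?thesis using tendsto_le[OF nt 2 1] by simp
      qed (auto simp: G_def)
      have "norm (f s - f a) \<le> e * (s - a)" if "s \<in> T" "a \<le> s" "s \<le> c" for s
        using below[of s] at_c that by (cases "s = c") auto
      then have cG: "c \<in> G" using cT ac by (simp add: G_def)
      have up: "\<exists>s\<in>T. c < s" using Gb[OF cG] \<open>b \<in> T\<close> by auto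
      note sig = ts_sigma_props[OF T(1) up]
      \<comment> \<open>If \<open>c\<close> is right-scattered, nothing of \<open>T\<close> lies
        inside the gap and \<open>f\<close> does not change across it, so
        \<open>ts_sigma T c\<close> joins \<open>G\<close>. If \<open>c\<close> is right-dense, the
        zero derivative keeps \<open>f\<close> in the cone up to some point of \<open>T\<close> just
        above \<open>c\<close>.\<close>
      show False
      proof (cases "ts_sigma T c = c")
        case False
        then have "c < ts_sigma T c" using sig(2) by simp
        have "ts_sigma T c \<in> G"
          unfolding G_def
        proof (intro CollectI conjI ballI impI)
          fix s assume "s \<in> T" "a \<le> s \<and> s \<le> ts_sigma T c"
          then consider "s < c" | "s = c" | "s = ts_sigma T c" using sig(3)[of s] by force
          then show "norm (f s - f a) \<le> e * (s - a)"
          proof cases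
            case 3
            have "e * (c - a) \<le> e * (s - a)"
              using \<open>0 < e\<close> \<open>c < ts_sigma T c\<close> 3 by simp
            then show ?thesis using at_c step[OF cT] 3 by simp
          qed (use below at_c \<open>s \<in> T\<close> \<open>a \<le> s \<and> _\<close> in auto)
        qed (use sig ac in auto)
        then have "ts_sigma T c \<le> c" using bdd by (auto simp: c_def intro: cSup_upper)
        then show False using \<open>c < ts_sigma T c\<close> by simp
      next
        case True
        from dense[OF cT True] obtain d where "0 < d" and
          d: "\<forall>y\<in>T. norm (y - c) < d \<longrightarrow> norm (f y - f c) \<le> e * norm (y - c)"
          unfolding has_vector_derivative_def has_derivative_within_alt using \<open>0 < e\<close> by auto
        obtain s where s: "s \<in> T" "c < s" "s < c + d"
          using ts_sigma_dense[OF up True \<open>0 < d\<close>] .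
        have "s \<in> G"
          unfolding G_def
        proof (intro CollectI conjI ballI impI)
          fix r assume r: "r \<in> T" "a \<le> r \<and> r \<le> s"
          show "norm (f r - f a) \<le> e * (r - a)"
          proof (cases "r \<le> c")
            case True
            then show ?thesis using below[of r] at_c r by (cases "r = c") auto
          next
            case False
            then have "norm (f r - f c) \<le> e * (r - c)" using d r s by auto
            moreover have "norm (f r - f a) \<le> norm (f r - f c) + norm (f c - f a)"
              using norm_triangle_ineq[of "f r - f c" "f c - f a"] by simp
            ultimately show ?thesis using at_c by (simp add: algebra_simps)
          qed
        qed (use s ac in auto)
        then have "s \<le> c" using bdd by (auto simp: c_def intro: cSup_upper)
        then show False using s by simp
      qed
    qed
    then have "norm (f b - f a) \<le> e" if "0 < e" for e
      using that \<open>a < b\<close> by (metis diff_gt_0_iff_gt divide_pos_pos less_irrefl nonzero_eq_divide_eq)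
    then have "norm (f b - f a) \<le> 0" by (metis dense_ge)
    then show ?thesis by simp
  qed
  show ?thesis using *[of a b] *[of b a] assms(4,5) by (cases a b rule: linorder_cases) auto
qed

text \<open>Two antiderivatives differ by a function with zero delta derivative, so the description
  in \<open>delta_integral\<close> has exactly one candidate.\<close>

lemma delta_integral_eq:
  assumes T: "closed T" "\<forall>t\<in>T. \<exists>s\<in>T. t < s"
    and F: "\<forall>t\<in>T. has_delta_derivative T F (f t) t" and "s \<in> T" "t \<in> T"
  shows "delta_integral T f s t = F t - F s"
  unfolding delta_integral_def
proof (rule the_equality)
  have kappa: "ts_kappa T = T" using ts_kappa_unbounded[OF T] .
  show "\<exists>F'. delta_antiderivative T F' f \<and> F t - F s = F' t - F' s"
    using F by (auto simp: delta_antiderivative_def kappa)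
  fix I assume "\<exists>F'. delta_antiderivative T F' f \<and> I = F' t - F' s"
  then obtain F' where F': "\<forall>t\<in>T. has_delta_derivative T F' (f t) t" and I: "I = F' t - F' s"
    by (auto simp: delta_antiderivative_def kappa)
  have "has_delta_derivative T (\<lambda>x. F' x - F x) 0 t" if "t \<in> T" for t
    using has_delta_derivative_diff[OF T(1) that, of F' "f t" F "f t"] T F F' that by simp
  then have "F' t - F t = F' s - F s"
    using zero_delta_derivative_constant[OF T, of "\<lambda>x. F' x - F x" t s] assms(4,5) by simp
  then have "F' t = F' s - F s + F t" by (rule diff_eq_eq[THEN iffD1])
  then show "I = F t - F s" using I by simp
qed

lemma graininess_antiderivative_exists:
  fixes g :: "real \<Rightarrow> 'a::euclidean_space"
  assumes T: "closed T" "\<forall>t\<in>T. \<exists>s\<in>T. t < s" and g: "continuous_on UNIV g"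
  shows "\<exists>F. \<forall>t\<in>T. has_delta_derivative T F (g (ts_mu T t)) t"
proof (cases "T = {}")
  case False
  then obtain t0 where t0: "t0 \<in> T" by auto
  note up = unbounded_above[OF T False]
  note sig = ts_sigma_props[OF T(1) up]
  \<comment> \<open>The last point of \<open>T\<close> at or before \<open>x\<close>. Below all of
    \<open>T\<close> the default \<open>x\<close> keeps \<open>l\<close> monotone and below the
    identity.\<close>
  define l where "l x = (if \<exists>s\<in>T. s \<le> x then Sup {s\<in>T. s \<le> x} else x)" for x
  have l: "l x \<le> x" "s \<in> T \<Longrightarrow> s \<le> x \<Longrightarrow> s \<le> l x" for s x
  proof -
    have bdd: "bdd_above {s\<in>T. s \<le> x}" by (auto intro: bdd_aboveI[of _ x])
    show "l x \<le> x" by (auto simp: l_def intro!: cSup_least)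
    show "s \<in> T \<Longrightarrow> s \<le> x \<Longrightarrow> s \<le> l x" using bdd by (auto simp: l_def intro!: cSup_upper)
  qed
  have "mono l"
  proof (rule monoI)
    fix x y :: real assume "x \<le> y"
    show "l x \<le> l y"
    proof (cases "\<exists>s\<in>T. s \<le> x")
      case True
      then have "l x = Sup {s\<in>T. s \<le> x}" by (simp add: l_def)
      also have "\<dots> \<le> l y" using True \<open>x \<le> y\<close> l(2)[of _ y] by (intro cSup_least) auto
      finally show ?thesis .
    next
      case False
      then have "l x = x" by (simp add: l_def)
      moreover have "x \<le> l y"
      proof (cases "\<exists>s\<in>T. s \<le> y")
        case True
        then obtain s where "s \<in> T" "s \<le> y" by auto
        then show ?thesis using l(2)[of s y] False by force
      qed (use \<open>x \<le> y\<close> in \<open>simp add: l_def\<close>)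
      ultimately show ?thesis by simp
    qed
  qed
  have "mono (ts_sigma T)"
  proof (rule monoI)
    fix x y :: real assume "x \<le> y"
    show "ts_sigma T x \<le> ts_sigma T y"
    proof (cases "x < ts_sigma T y")
      case True then show ?thesis using sig by blast
    next
      case False
      then have "ts_sigma T y = y" "x = y" using sig(2)[of y] \<open>x \<le> y\<close> by auto
      then show ?thesis by simp
    qed
  qed
  \<comment> \<open>\<open>m\<close> is the length of the gap of \<open>T\<close> around \<open>x\<close>; it agrees with the graininess on \<open>T\<close>.\<close>
  define m where "m x = ts_sigma T x - l x" for x
  have m_nonneg: "0 \<le> m x" for x using l(1)[of x] sig(2)[of x] by (simp add: m_def)
  have m_le: "m x \<le> ts_sigma T b - l a" if "a \<le> x" "x \<le> b" for a b x
    using monoD[OF \<open>mono l\<close> that(1)] monoD[OF \<open>mono (ts_sigma T)\<close> that(2)] by (simp add: m_def)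
  define h where "h x = g (m x)" for x
  \<comment> \<open>The gap length is a difference of two monotone functions, hence Borel;
    monotonicity also bounds it on compact intervals, which gives integrability of \<open>h\<close>
    there.\<close>
  have meas: "h \<in> borel_measurable borel"
    unfolding h_def m_def
    by (intro measurable_compose[OF _ borel_measurable_continuous_onI[OF g]]
        borel_measurable_diff borel_measurable_mono \<open>mono l\<close> \<open>mono (ts_sigma T)\<close>)
  have int: "h integrable_on {a..b}" for a b
  proof -
    have "compact (g ` {0..ts_sigma T b - l a})"
      using g by (intro compact_continuous_image) (auto intro: continuous_on_subset)
    then obtain B where B: "\<forall>y\<in>g ` {0..ts_sigma T b - l a}. norm y \<le> B"
      using compact_imp_bounded bounded_iff by metis
    show ?thesis
    proof (rule measurable_bounded_by_integrable_imp_integrable[of h _ "\<lambda>_. B"])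
      have "h \<in> borel_measurable lebesgue" using meas by (intro measurable_completion) simp
      then show "h \<in> borel_measurable (lebesgue_on {a..b})" by (rule measurable_restrict_space1)
      show "norm (h x) \<le> B" if "x \<in> {a..b}" for x
        using B m_nonneg[of x] m_le[of a x b] that by (auto simp: h_def)
    qed auto
  qed
  \<comment> \<open>The oriented integral from \<open>t0\<close> to \<open>t\<close>: one of the two
    terms is always zero, its interval being empty or a single point.\<close>
  define F where "F t = integral {t0..t} h - integral {t..t0} h" for t
  have F_eq: "F t = integral {a..t} h - integral {a..t0} h" if "a \<le> t" "a \<le> t0" for a t
  proof (cases "t0 \<le> t")
    case True
    then have "integral {a..t0} h + integral {t0..t} h = integral {a..t} h"
      using that int by (intro Henstock_Kurzweil_Integration.integral_combine) auto
    moreover have "integral {t..t0} h = 0" using True by (cases "t = t0") auto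
    ultimately show ?thesis by (simp add: F_def algebra_simps)
  next
    case False
    then have "integral {a..t} h + integral {t..t0} h = integral {a..t0} h"
      using that int by (intro Henstock_Kurzweil_Integration.integral_combine) auto
    then show ?thesis using False by (simp add: F_def algebra_simps)
  qed
  have F_diff: "F t - F s = integral {s..t} h" if "s \<le> t" for s t
  proof -
    have eq: "integral {min s t0..t} h = integral {min s t0..s} h + integral {s..t} h"
      using that int by (intro Henstock_Kurzweil_Integration.integral_combine[symmetric]) auto
    have "F s = integral {min s t0..s} h - integral {min s t0..t0} h"
      "F t = integral {min s t0..t} h - integral {min s t0..t0} h"
      using that by (auto intro: F_eq)
    then show ?thesis unfolding eq by simp
  qed
  have F_cont: "isCont F t" for t
  proof -
    let ?a = "min t t0 - 1" and ?b = "t + 1"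
    have "continuous_on {?a..?b} (\<lambda>x. integral {?a..x} h - integral {?a..t0} h)"
      by (intro continuous_intros indefinite_integral_continuous_1 int)
    then have "continuous_on {?a..?b} F"
      by (rule continuous_on_eq) (auto simp: F_eq[of ?a])
    then show ?thesis by (rule continuous_on_interior) auto
  qed
  have F_bound: "norm (F t - F s - (t - s) *\<^sub>R c) \<le> e * (t - s)"
    if "s \<le> t" "0 \<le> e" "\<And>x. s \<le> x \<Longrightarrow> x \<le> t \<Longrightarrow> norm (h x - c) \<le> e" for s t e c
  proof -
    have "(h has_integral F t - F s) {s..t}"
      using int F_diff[OF that(1)] by (simp add: has_integral_integral)
    then have "((\<lambda>x. h x - c) has_integral F t - F s - (t - s) *\<^sub>R c) {s..t}"
      using has_integral_const_real[of c s t] that(1) by (intro has_integral_diff) auto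
    then show ?thesis
      using has_integral_bound_real[of e "{}" "\<lambda>x. h x - c" _ s t] that by auto
  qed
  have "has_delta_derivative T F (g (ts_mu T t)) t" if t: "t \<in> T" for t
    unfolding has_delta_derivative_iff[OF T(1) t up]
  proof (intro conjI impI)
    show "continuous (at t within T) F" using F_cont by (rule continuous_at_imp_continuous_at_within)
    have h_eq: "h x = g (ts_mu T t)" if x: "t \<le> x" "x < ts_sigma T t" for x
    proof -
      have "ts_sigma T x = ts_sigma T t"
      proof (rule antisym)
        show "ts_sigma T x \<le> ts_sigma T t" using sig x by blast
        show "ts_sigma T t \<le> ts_sigma T x"
          using monoD[OF \<open>mono (ts_sigma T)\<close> x(1)] .
      qed
      moreover have "l x = t"
      proof (rule antisym)
        show "t \<le> l x" using l(2) t x by blast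
        have "{s\<in>T. s \<le> x} \<noteq> {}" "\<And>s. s \<in> T \<Longrightarrow> s \<le> x \<Longrightarrow> s \<le> t"
          using t x sig(3)[of _ t] by force+
        then show "l x \<le> t" using t x(1) unfolding l_def by (auto intro!: cSup_least)
      qed
      ultimately show ?thesis by (simp add: h_def m_def ts_mu_def)
    qed
    \<comment> \<open>\<open>h\<close> is constant on the half-open gap only; the right endpoint may
      already carry another gap length, but it is a null set.\<close>
    have "F (ts_sigma T t) - F t = integral {t..ts_sigma T t} (\<lambda>_. g (ts_mu T t))"
      unfolding F_diff[OF sig(2)]
      by (rule integral_spike[of "{ts_sigma T t}"]) (auto simp: h_eq)
    then show "F (ts_sigma T t) - F t = ts_mu T t *\<^sub>R g (ts_mu T t)"
      using sig(2)[of t] by (simp add: ts_mu_def)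
    assume dense: "ts_sigma T t = t"
    then have mu0: "ts_mu T t = 0" by (simp add: ts_mu_def)
    show "(F has_vector_derivative g (ts_mu T t)) (at t within T)"
      unfolding has_vector_derivative_def has_derivative_within_alt mu0
    proof (intro conjI allI impI)
      fix e :: real assume "0 < e"
      have "isCont g 0" using g by (simp add: continuous_on_eq_continuous_at)
      then obtain d where "0 < d" and d: "\<And>y. norm (y - 0) < d \<Longrightarrow> norm (g y - g 0) < e"
        using \<open>0 < e\<close> unfolding continuous_at_eps_delta dist_norm by blast
      \<comment> \<open>For \<open>t \<le> x < q\<close> the gap around \<open>x\<close> lies in
        \<open>[t, q]\<close>, so it is shorter than \<open>d\<close>. On the left of
        \<open>t\<close> the gaps around points between \<open>y\<close> and \<open>t\<close> lie in
        \<open>[y, t]\<close>, because \<open>t\<close> is right-dense.\<close>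
      obtain q where q: "q \<in> T" "t < q" "q < t + d"
        using ts_sigma_dense[OF up dense \<open>0 < d\<close>] .
      have "norm (F y - F t - (y - t) *\<^sub>R g 0) \<le> e * norm (y - t)"
        if y: "y \<in> T" "norm (y - t) < min (q - t) d" for y
      proof (cases "t \<le> y")
        case True
        have "norm (h x - g 0) \<le> e" if x: "t \<le> x" "x \<le> y" for x
        proof -
          have "m x \<le> q - t" using l(2)[OF t x(1)] sig(3)[OF q(1), of x] x y by (auto simp: m_def)
          then show ?thesis using d[of "m x"] m_nonneg[of x] q unfolding h_def by force
        qed
        then show ?thesis using F_bound[of t y e "g 0"] True \<open>0 < e\<close> by auto
      next
        case False
        have "norm (h x - g 0) \<le> e" if x: "y \<le> x" "x \<le> t" for x
        proof -
          have "ts_sigma T x \<le> t"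
            using monoD[OF \<open>mono (ts_sigma T)\<close> x(2)] dense by simp
          then have "m x \<le> t - y" using l(2)[OF y(1) x(1)] by (auto simp: m_def)
          then show ?thesis using d[of "m x"] m_nonneg[of x] y False unfolding h_def by force
        qed
        then have "norm (F t - F y - (t - y) *\<^sub>R g 0) \<le> e * (t - y)"
          using F_bound[of y t e "g 0"] False \<open>0 < e\<close> by auto
        moreover have "F t - F y - (t - y) *\<^sub>R g 0 = - (F y - F t - (y - t) *\<^sub>R g 0)"
          by (simp add: algebra_simps)
        ultimately show ?thesis using False by (simp only: norm_minus_cancel) simp
      qed
      then show "\<exists>d>0. \<forall>y\<in>T. norm (y - t) < d \<longrightarrow> norm (F y - F t - (y - t) *\<^sub>R g 0) \<le> e * norm (y - t)"
        using q \<open>0 < d\<close> by (intro exI[of _ "min (q - t) d"]) auto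
    qed (rule bounded_linear_scaleR_left)
  qed
  then show ?thesis by blast
qed simp

section \<open>Matrix polynomials and the Cayley--Hamilton theorem\<close>

lemma mat_mult_left: "mat c ** A = (\<chi> i j. c * A $ i $ j)" for A :: "'a::semiring_1^'n^'m"
  by (simp add: vec_eq_iff matrix_matrix_mult_def mat_def if_distrib if_distribR sum.delta' cong: if_cong)

lemma mat_mult_right: "A ** mat c = (\<chi> i j. A $ i $ j * c)" for A :: "'a::semiring_1^'n^'m"
  by (simp add: vec_eq_iff matrix_matrix_mult_def mat_def if_distrib if_distribR sum.delta cong: if_cong)

lemma mat_commute: "mat c ** A = A ** mat c" for A :: "'a::comm_semiring_1^'n^'n"
  by (simp add: mat_mult_left mat_mult_right mult.commute)

lemma mat_add: "mat (a + b) = mat a + mat b" for a b :: "'a::monoid_add"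
  by (simp add: vec_eq_iff mat_def)

lemma mat_mult: "mat (a * b) = mat a ** (mat b :: 'a::semiring_1^'n^'n)"
  unfolding mat_mult_left by (simp add: vec_eq_iff mat_def)

lemma mat_left_commute: "A ** (mat c ** B) = mat c ** (A ** B)" for A B :: "'a::comm_semiring_1^'n^'n"
  by (metis mat_commute matrix_mul_assoc)

lemma matrix_add_rdistrib: "(A + B) ** C = A ** C + B ** C" for A B :: "'a::semiring_1^'n^'m"
  by (simp add: vec_eq_iff matrix_matrix_mult_def distrib_right sum.distrib)

lemma matrix_mult_sum_right: "A ** sum f S = (\<Sum>x\<in>S. A ** f x)" for A :: "'a::semiring_1^'n^'m"
  by (induction S rule: infinite_finite_induct) (auto simp: matrix_add_ldistrib)

lemma matrix_mult_minus_right: "A ** (- B) = - (A ** B)" for A :: "'a::ring_1^'n^'m"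
  by (simp add: vec_eq_iff matrix_matrix_mult_def sum_negf)

lemma mat_power_0 [simp]: "mat_power A 0 = mat 1"
  and mat_power_Suc: "mat_power A (Suc k) = A ** mat_power A k"
  by (simp_all add: mat_power_def)

lemma mat_power_Suc2: "mat_power A (Suc k) = mat_power A k ** A"
  by (induction k) (simp_all add: mat_power_Suc matrix_mul_assoc)

lemma mat_poly_eq_sum:
  assumes "degree q \<le> n"
  shows "mat_poly q A = (\<Sum>k\<le>n. mat (coeff q k) ** mat_power A k)"
  unfolding mat_poly_def using assms
  by (intro sum.mono_neutral_left) (auto simp: coeff_eq_0 not_le)

lemma mat_poly_0 [simp]: "mat_poly 0 A = 0"
  by (simp add: mat_poly_def)

lemma mat_poly_pCons: "mat_poly (pCons a p) A = mat a + A ** mat_poly p A"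
proof -
  have "mat_poly (pCons a p) A = (\<Sum>k\<le>Suc (degree p). mat (coeff (pCons a p) k) ** mat_power A k)"
    by (intro mat_poly_eq_sum) (simp add: degree_pCons_le)
  also have "\<dots> = mat a + (\<Sum>k\<le>degree p. A ** (mat (coeff p k) ** mat_power A k))"
    by (subst sum.atMost_Suc_shift) (simp add: mat_power_Suc mat_left_commute)
  finally show ?thesis by (simp add: mat_poly_def matrix_mult_sum_right)
qed

lemma mat_poly_add: "mat_poly (p + q) A = mat_poly p A + mat_poly q A"
proof -
  let ?n = "max (degree p) (degree q)"
  have "mat_poly r A = (\<Sum>k\<le>?n. mat (coeff r k) ** mat_power A k)" if "r \<in> {p, q, p + q}" for r
    using that degree_add_le_max[of p q] by (intro mat_poly_eq_sum) auto
  then show ?thesis by (simp add: mat_add matrix_add_rdistrib sum.distrib)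
qed

lemma mat_poly_const [simp]: "mat_poly [:a:] A = mat a"
  by (simp add: mat_poly_pCons)

lemma mat_poly_1 [simp]: "mat_poly 1 A = mat 1"
  by (simp add: one_pCons del: pCons_one)

lemma mat_poly_mult: "mat_poly (p * q) A = mat_poly p A ** mat_poly q A"
proof (induction p)
  case (pCons a p)
  have smult: "mat_poly (smult a q) A = mat a ** mat_poly q A" for q
    by (induction q) (simp_all add: mat_poly_pCons matrix_add_ldistrib mat_left_commute mat_mult)
  show ?case
    by (simp add: pCons.IH mat_poly_add mat_poly_pCons smult matrix_add_rdistrib matrix_mul_assoc mat_def[of 0]
        flip: zero_vec_def)
qed simp

lemma mat_poly_smult: "mat_poly (smult a q) A = mat a ** mat_poly q A"
  using mat_poly_mult[of "[:a:]" q A] by simp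

lemma mat_poly_power: "mat_poly (p ^ k) A = mat_power (mat_poly p A) k"
  by (induction k) (simp_all add: mat_poly_mult mat_power_Suc)

lemma mat_poly_sum: "mat_poly (sum f S) A = (\<Sum>x\<in>S. mat_poly (f x) A)"
  by (induction S rule: infinite_finite_induct) (simp_all add: mat_poly_add)

text \<open>Multiplication by the adjugate, whose \<open>(k, j)\<close> entry is the determinant of \<open>A\<close> with row
  \<open>j\<close> replaced by the \<open>k\<close>-th unit vector.\<close>

lemma sum_row_mult_adjugate:
  fixes A :: "'a::comm_ring_1^'n^'n"
  shows "(\<Sum>k\<in>UNIV. A $ i $ k * det (\<chi> r. if r = j then axis k 1 else A $ r)) =
    (if i = j then det A else 0)"
proof -
  have "(\<Sum>k\<in>UNIV. A $ i $ k * det (\<chi> r. if r = j then axis k 1 else A $ r)) =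
      det (\<chi> r. if r = j then (\<Sum>k\<in>UNIV. A $ i $ k *s axis k 1) else A $ r)"
    by (simp add: det_row_mul det_linear_row_sum)
  also have "\<dots> = det (\<chi> r. if r = j then A $ i else A $ r)"
    unfolding basis_expansion ..
  also have "\<dots> = (if i = j then det A else 0)"
  proof (cases "i = j")
    case True
    then have "(\<chi> r. if r = j then A $ i else A $ r) = A" by (auto simp: vec_eq_iff)
    then show ?thesis using True by simp
  next
    case False
    then show ?thesis
      by (simp, intro det_identical_rows[of i j]) (auto simp: row_def vec_eq_iff)
  qed
  finally show ?thesis .
qed

text \<open>The identity (x I - M) adj(x I - M) = c(x) I is compared coefficientwise, with
  \<open>C m\<close> the matrix coefficient of x^m in the adjugate. Multiplying the m-th equation by
  M^m from the left makes the sum telescope to a single term, which vanishes beyond the degree of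
  the adjugate.\<close>

theorem Cayley_Hamilton:
  fixes M :: "complex^'n^'n"
  shows "mat_poly (char_polynomial M) M = 0"
proof -
  define A where "A = (\<chi> i j. (if i = j then [:0, 1:] else 0) - [:M $ i $ j:])"
  define c where "c = char_polynomial M"
  define B where "B k j = det (\<chi> r. if r = j then axis k 1 else A $ r)" for k j
  define C :: "nat \<Rightarrow> complex^'n^'n" where "C m = (\<chi> k j. coeff (B k j) m)" for m
  have c: "c = det A" by (simp add: c_def A_def char_polynomial_def)
  have coeff_c: "mat (coeff c m) = (case m of 0 \<Rightarrow> 0 | Suc m' \<Rightarrow> C m') - M ** C m" for m
  proof -
    have "(if i = j then coeff c m else 0) =
        (case m of 0 \<Rightarrow> 0 | Suc m' \<Rightarrow> C m' $ i $ j) - (M ** C m) $ i $ j" for i j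
    proof -
      have "(if i = j then coeff c m else 0) = coeff (\<Sum>k\<in>UNIV. A $ i $ k * B k j) m"
        unfolding B_def sum_row_mult_adjugate c by simp
      also have "\<dots> = (\<Sum>k\<in>UNIV. (if i = k then coeff (pCons 0 (B k j)) m else 0) - M $ i $ k * coeff (B k j) m)"
        unfolding coeff_sum by (intro sum.cong refl) (auto simp: A_def left_diff_distrib)
      also have "\<dots> = coeff (pCons 0 (B i j)) m - (M ** C m) $ i $ j"
        by (simp add: sum_subtractf matrix_matrix_mult_def C_def)
      finally show ?thesis by (cases m) (simp_all add: C_def)
    qed
    then show ?thesis by (auto simp: vec_eq_iff mat_def split: nat.split)
  qed
  have telescope: "(\<Sum>m\<le>n. mat (coeff c m) ** mat_power M m) = - (mat_power M (Suc n) ** C n)" for n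
  proof (induction n)
    case 0
    then show ?case by (simp add: coeff_c mat_power_Suc)
  next
    case (Suc n)
    have "mat (coeff c (Suc n)) ** mat_power M (Suc n) =
        mat_power M (Suc n) ** C n - mat_power M (Suc n) ** (M ** C (Suc n))"
      by (subst mat_commute)
        (simp add: coeff_c matrix_add_ldistrib matrix_mult_minus_right flip: add_uminus_conv_diff)
    also have "mat_power M (Suc n) ** (M ** C (Suc n)) = mat_power M (Suc (Suc n)) ** C (Suc n)"
      by (simp only: matrix_mul_assoc flip: mat_power_Suc2)
    finally show ?case using Suc by simp
  qed
  \<comment> \<open>Large enough to sum all of \<open>c\<close> and, by the \<open>Suc\<close>,
    strictly above the degree of every adjugate entry, so that \<open>C n = 0\<close>.\<close>
  define n where "n = Max (insert (degree c) (range (\<lambda>(k, j). Suc (degree (B k j)))))"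
  have "degree c \<le> n" unfolding n_def by (rule Max_ge) auto
  have "degree (B k j) < n" for k j
  proof -
    have "Suc (degree (B k j)) \<le> n" unfolding n_def by (rule Max_ge) (auto intro!: image_eqI[of _ _ "(k, j)"])
    then show ?thesis by simp
  qed
  then have "C n = 0" by (simp add: C_def vec_eq_iff coeff_eq_0)
  then show ?thesis
    using telescope[of n] mat_poly_eq_sum[OF \<open>degree c \<le> n\<close>, of M] by (simp add: c_def)
qed

section \<open>Roots, degree and factorisation of the characteristic polynomial\<close>

lemma poly_char_polynomial:
  fixes M :: "complex^'n^'n"
  shows "poly (char_polynomial M) z = det (mat z - M)"
proof -
  have "poly (det A) z = det (\<chi> i j. poly (A $ i $ j) z)"
    for A :: "complex poly^'n^'n"
    by (simp add: det_def poly_sum poly_prod)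
  then show ?thesis
    unfolding char_polynomial_def
    by (auto intro!: arg_cong[where f = det] simp: vec_eq_iff mat_def)
qed

lemma eigenvalues_eq_roots:
  fixes M :: "complex^'n^'n"
  shows "eigenvalues M = {z. poly (char_polynomial M) z = 0}"
proof -
  have "z \<in> eigenvalues M \<longleftrightarrow> (\<exists>v. v \<noteq> 0 \<and> (mat z - M) *v v = 0)" for z
  proof -
    have "mat z *v v = z *s v" for v :: "complex^'n"
      by (simp add: vec_eq_iff matrix_vector_mult_def mat_def if_distrib if_distribR sum.delta' cong: if_cong)
    then show ?thesis by (auto simp: eigenvalues_def matrix_vector_mult_diff_rdistrib)
  qed
  also have "(\<exists>v. v \<noteq> 0 \<and> (mat z - M) *v v = 0) \<longleftrightarrow> det (mat z - M) = 0" for z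
    by (metis invertible_det_nz invertible_left_inverse matrix_left_invertible_ker)
  finally show ?thesis by (auto simp: poly_char_polynomial)
qed

text \<open>In the Leibniz sum only diagonal entries have positive degree, so a permutation
  contributes degree at most its number of fixed points. Only the identity reaches
  \<open>CARD('n)\<close>, and its term is a product of monic linear factors.\<close>

lemma char_polynomial_monic:
  fixes M :: "complex^'n^'n"
  shows "lead_coeff (char_polynomial M) = 1" and "degree (char_polynomial M) = CARD('n)"
proof -
  define A where "A = (\<chi> i j. (if i = j then [:0, 1:] else 0) - [:M $ i $ j:])"
  define N where "N = CARD('n)"
  have deg: "degree (A $ i $ j) \<le> (if i = j then 1 else 0)" for i j
    by (simp add: A_def)
  define f where "f p = (\<Prod>i\<in>UNIV. A $ i $ p i)" for p
  have c: "char_polynomial M = (\<Sum>p | p permutes UNIV. of_int (sign p) * f p)"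
    by (simp add: char_polynomial_def det_def A_def f_def)
  have deg_f: "degree (f p) \<le> card {i. p i = i}" for p
  proof -
    have "degree (f p) \<le> (\<Sum>i\<in>UNIV. degree (A $ i $ p i))"
      using degree_prod_sum_le[of UNIV "\<lambda>i. A $ i $ p i"] by (simp add: f_def o_def)
    also have "\<dots> \<le> (\<Sum>i\<in>UNIV. if p i = i then 1 else 0)"
      using deg by (intro sum_mono) (metis (full_types))
    also have "\<dots> = card {i. p i = i}" by (subst sum.inter_filter[symmetric]) simp_all
    finally show ?thesis .
  qed
  have deg_f': "degree (f p) < N" if "p \<noteq> id" for p
  proof -
    have "{i. p i = i} \<subset> UNIV" using that by (auto simp: fun_eq_iff)
    then have "card {i. p i = i} < N" unfolding N_def by (intro psubset_card_mono) auto
    then show ?thesis using deg_f[of p] by simp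
  qed
  have f_id: "coeff (f id) N = 1"
  proof -
    have A_ii: "A $ i $ i = [:- (M $ i $ i), 1:]" for i by (simp add: A_def)
    have "degree (f id) = N"
      unfolding f_def N_def by (subst degree_prod_eq_sum_degree) (auto simp: A_ii)
    moreover have "lead_coeff (f id) = 1"
      unfolding f_def by (subst lead_coeff_prod) (simp add: A_ii)
    ultimately show ?thesis by simp
  qed
  have coeff_term: "coeff (of_int (sign p) * f p) N = (if p = id then 1 else 0)" for p
    using deg_f'[of p] f_id by (cases "p = id") (auto simp: of_int_poly coeff_eq_0)
  have "coeff (char_polynomial M) N = 1"
    by (simp add: c coeff_sum coeff_term permutes_id)
  moreover have "degree (char_polynomial M) \<le> N"
    unfolding c
  proof (intro degree_sum_le)
    fix p
    have "degree (f p) \<le> N" using deg_f[of p] card_mono[of UNIV "{i. p i = i}"] by (simp add: N_def)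
    then show "degree (of_int (sign p) * f p) \<le> N" by (simp add: of_int_poly)
  qed simp
  ultimately have "degree (char_polynomial M) = N"
    by (metis le_antisym le_degree zero_neq_one)
  with \<open>coeff (char_polynomial M) N = 1\<close>
  show "lead_coeff (char_polynomial M) = 1" "degree (char_polynomial M) = CARD('n)"
    by (simp_all add: N_def)
qed

lemma finite_eigenvalues: "finite (eigenvalues M)"
  unfolding eigenvalues_eq_roots
  by (rule poly_roots_finite) (use char_polynomial_monic(1)[of M] in auto)

lemma eigenvalues_nonempty: "eigenvalues M \<noteq> {}"
proof -
  have "\<not> constant (poly (char_polynomial M))"
    using char_polynomial_monic(2)[of M] by (simp add: constant_degree)
  then show ?thesis
    using fundamental_theorem_of_algebra by (auto simp: eigenvalues_eq_roots)
qed

lemma alg_mult_pos: "l \<in> eigenvalues M \<Longrightarrow> 0 < alg_mult M l"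
  using order_root[of "char_polynomial M" l] char_polynomial_monic(1)[of M]
  by (auto simp: alg_mult_def eigenvalues_eq_roots)

lemma eigenvalue_nonzero: "invertible M \<Longrightarrow> l \<in> eigenvalues M \<Longrightarrow> l \<noteq> 0"
  by (auto simp: eigenvalues_def) (metis invertible_left_inverse matrix_left_invertible_ker)

lemma char_polynomial_decompose:
  "char_polynomial M = (\<Prod>l\<in>eigenvalues M. [:- l, 1:] ^ alg_mult M l)"
  using complex_poly_decompose[of "char_polynomial M"]
  unfolding char_polynomial_monic(1) eigenvalues_eq_roots alg_mult_def by simp

section \<open>Partial fractions and real powers\<close>

lemma coprime_linear_powers:
  fixes a b :: complex
  assumes "a \<noteq> b"
  shows "coprime ([:- a, 1:] ^ m) ([:- b, 1:] ^ n)"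
proof -
  have "coprime [:- a, 1:] [:- b, 1:]"
  proof (rule coprimeI)
    fix d assume "d dvd [:- a, 1:]" "d dvd [:- b, 1:]"
    then have "d dvd [:- a, 1:] - [:- b, 1:]" by (rule dvd_diff)
    then have "d dvd [:b - a:]" by simp
    moreover have "is_unit [:b - a:]" using assms by (intro is_unit_triv) simp
    ultimately show "is_unit d" by (rule dvd_trans)
  qed
  then show ?thesis by simp
qed

lemma prod_linear_powers_dvd:
  fixes p :: "complex poly"
  assumes "finite S" "\<And>l. l \<in> S \<Longrightarrow> [:- l, 1:] ^ m l dvd p"
  shows "(\<Prod>l\<in>S. [:- l, 1:] ^ m l) dvd p"
  using assms
proof (induction S rule: finite_induct)
  case (insert l S)
  then have "coprime ([:- l, 1:] ^ m l) (\<Prod>l\<in>S. [:- l, 1:] ^ m l)"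
    by (intro prod_coprime_right coprime_linear_powers) auto
  then show ?case using insert by (simp add: divides_mult)
qed simp

lemma prod_linear_powers_remove:
  fixes S :: "complex set"
  assumes "finite S" "l \<in> S"
  shows "(\<Prod>l\<in>S. [:- l, 1:] ^ m l) = [:- l, 1:] ^ m l * (\<Prod>k\<in>S - {l}. [:- k, 1:] ^ m k)"
  using assms by (rule prod.remove)

lemma linear_power_dvd_cofactor:
  fixes S :: "complex set"
  assumes "finite S" "l \<in> S" "k \<noteq> l"
  shows "[:- l, 1:] ^ m l dvd (\<Prod>j\<in>S - {k}. [:- j, 1:] ^ m j)"
  using assms by (intro dvd_prodI) auto

lemma coprime_cofactor:
  fixes S :: "complex set"
  shows "coprime ([:- l, 1:] ^ m l) (\<Prod>k\<in>S - {l}. [:- k, 1:] ^ m k)"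
  by (intro prod_coprime_right coprime_linear_powers) auto

lemma degree_prod_linear_powers:
  "degree (\<Prod>l\<in>S. [:- l, 1:] ^ m l) = (\<Sum>l\<in>S. m l)" for S :: "complex set"
  by (simp add: degree_prod_sum_eq degree_power_eq)

text \<open>Choose each numerator as an inverse of the cofactor modulo its own linear power. The sum
  minus 1 is then divisible by every linear power, hence by their product, while its degree is
  smaller; so it is zero. Positive multiplicities are what puts the constant 1 below that
  degree.\<close>

lemma partial_fractions_exist:
  fixes S :: "complex set"
  assumes "finite S" "S \<noteq> {}" "\<And>l. l \<in> S \<Longrightarrow> 0 < m l"
  obtains a where "\<And>l. l \<notin> S \<Longrightarrow> a l = 0" "\<And>l. l \<in> S \<Longrightarrow> degree (a l) < m l"
    "(\<Sum>l\<in>S. a l * (\<Prod>k\<in>S - {l}. [:- k, 1:] ^ m k)) = 1"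
proof -
  define w where "w l = [:- l, 1:] ^ m l" for l :: complex
  define b where "b l = (\<Prod>k\<in>S - {l}. w k)" for l
  \<comment> \<open>A Bezout coefficient inverts \<open>b l\<close> modulo \<open>w l\<close>;
    reducing it modulo \<open>w l\<close> secures the degree bound without changing that.\<close>
  define a where "a l = (if l \<in> S then fst (bezout_coefficients (b l) (w l)) mod w l else 0)" for l
  have w: "w l \<noteq> 0" "degree (w l) = m l" for l
    by (simp_all add: w_def degree_power_eq)
  have deg_a: "degree (a l) < m l" if "l \<in> S" for l
    using degree_mod_less[OF w(1)[of l], of "fst (bezout_coefficients (b l) (w l))"] assms(3)[OF that] that
    by (auto simp: a_def w(2))
  have inverse: "w l dvd a l * b l - 1" if "l \<in> S" for l
  proof -
    define x y where "x = fst (bezout_coefficients (b l) (w l))" and "y = snd (bezout_coefficients (b l) (w l))"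
    have "coprime (b l) (w l)"
      using coprime_cofactor[of l m S] by (simp add: w_def b_def coprime_commute)
    then have bezout: "x * b l + y * w l = 1"
      using bezout_coefficients_fst_snd[of "b l" "w l"] by (simp add: x_def y_def coprime_imp_gcd_eq_1)
    have "a l = x - x div w l * w l"
      using that by (simp add: a_def x_def minus_div_mult_eq_mod)
    then have "a l * b l - 1 = (x - x div w l * w l) * b l - (x * b l + y * w l)"
      by (simp only: bezout)
    also have "\<dots> = w l * (- y - x div w l * b l)"
      by (simp add: algebra_simps)
    finally have "a l * b l - 1 = w l * (- y - x div w l * b l)" .
    then show ?thesis by simp
  qed
  define D where "D = (\<Sum>l\<in>S. a l * b l) - 1"
  have "w l dvd D" if "l \<in> S" for l
  proof -
    have "D = (a l * b l - 1) + (\<Sum>k\<in>S - {l}. a k * b k)"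
      using sum.remove[OF assms(1) that, of "\<lambda>l. a l * b l"] by (simp add: D_def)
    moreover have "w l dvd (\<Sum>k\<in>S - {l}. a k * b k)"
      unfolding b_def w_def
      by (intro dvd_sum dvd_mult linear_power_dvd_cofactor assms(1) that) auto
    ultimately show ?thesis using inverse[OF that] by simp
  qed
  then have dvd: "(\<Prod>l\<in>S. w l) dvd D"
    unfolding w_def by (intro prod_linear_powers_dvd assms(1))
  have deg_w: "degree (\<Prod>l\<in>S. w l) = (\<Sum>l\<in>S. m l)"
    by (simp add: w_def degree_prod_linear_powers)
  obtain l0 where "l0 \<in> S" using assms(2) by auto
  have "m l0 \<le> (\<Sum>l\<in>S. m l)" by (rule member_le_sum) (use \<open>l0 \<in> S\<close> assms in auto)
  then have pos: "0 < (\<Sum>l\<in>S. m l)" using assms(3)[OF \<open>l0 \<in> S\<close>] by simp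
  have "degree (a l * b l) < (\<Sum>l\<in>S. m l)" if "l \<in> S" for l
  proof -
    have "degree (a l * b l) \<le> degree (a l) + (\<Sum>k\<in>S - {l}. m k)"
      using degree_mult_le[of "a l" "b l"] by (simp add: b_def w_def degree_prod_linear_powers)
    also have "\<dots> < m l + (\<Sum>k\<in>S - {l}. m k)" using deg_a[OF that] by simp
    also have "\<dots> = (\<Sum>l\<in>S. m l)" using sum.remove[OF assms(1) that, of m] by simp
    finally show ?thesis .
  qed
  then have "degree D < (\<Sum>l\<in>S. m l)"
    unfolding D_def using pos by (intro degree_diff_less degree_sum_less) auto
  then have "D = 0" using dvd_imp_degree_le[OF dvd] deg_w by linarith
  then show ?thesis
    using deg_a by (intro that[of a]) (auto simp: a_def D_def b_def w_def)
qed

text \<open>Modulo the linear power at \<open>l\<close> every summand but the one at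
  \<open>l\<close> vanishes, and the cofactor at \<open>l\<close> can be cancelled. So the linear
  power divides a difference of smaller degree.\<close>

lemma partial_fractions_unique:
  fixes S :: "complex set"
  assumes "finite S"
    and a: "\<And>l. l \<in> S \<Longrightarrow> degree (a l) < m l" "\<And>l. l \<in> S \<Longrightarrow> degree (a' l) < m l"
    and eq: "(\<Sum>l\<in>S. a l * (\<Prod>k\<in>S - {l}. [:- k, 1:] ^ m k)) =
      (\<Sum>l\<in>S. a' l * (\<Prod>k\<in>S - {l}. [:- k, 1:] ^ m k))"
    and "l \<in> S"
  shows "a l = a' l"
proof (rule ccontr)
  let ?b = "\<lambda>l. \<Prod>k\<in>S - {l}. [:- k, 1:] ^ m k"
  assume "a l \<noteq> a' l"
  have "(\<Sum>k\<in>S. (a k - a' k) * ?b k) = 0"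
    using eq by (simp add: left_diff_distrib sum_subtractf)
  then have "(a l - a' l) * ?b l = - (\<Sum>k\<in>S - {l}. (a k - a' k) * ?b k)"
    using sum.remove[OF assms(1) \<open>l \<in> S\<close>, of "\<lambda>k. (a k - a' k) * ?b k"] by (simp add: eq_neg_iff_add_eq_0)
  moreover have "[:- l, 1:] ^ m l dvd (\<Sum>k\<in>S - {l}. (a k - a' k) * ?b k)"
    by (intro dvd_sum dvd_mult linear_power_dvd_cofactor assms(1) \<open>l \<in> S\<close>) auto
  ultimately have "[:- l, 1:] ^ m l dvd (a l - a' l) * ?b l" by simp
  then have "[:- l, 1:] ^ m l dvd a l - a' l"
    using coprime_cofactor[of l m S] by (simp add: coprime_dvd_mult_left_iff)
  then have "m l \<le> degree (a l - a' l)"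
    using dvd_imp_degree_le[of "[:- l, 1:] ^ m l" "a l - a' l"] \<open>a l \<noteq> a' l\<close> by (simp add: degree_power_eq)
  moreover have "degree (a l - a' l) < m l"
    using a[OF \<open>l \<in> S\<close>] by (rule degree_diff_less)
  ultimately show False by simp
qed

text \<open>Clearing denominators turns the equation of rational functions, required only off the
  finite set \<open>S\<close>, into a polynomial equation at infinitely many points.\<close>

lemma partial_fractions_function_iff:
  fixes S :: "complex set"
  assumes "finite S"
  shows "(\<forall>z. z \<notin> S \<longrightarrow> 1 / poly (\<Prod>l\<in>S. [:- l, 1:] ^ m l) z = (\<Sum>l\<in>S. poly (a l) z / (z - l) ^ m l)) \<longleftrightarrow>
    (\<Sum>l\<in>S. a l * (\<Prod>k\<in>S - {l}. [:- k, 1:] ^ m k)) = 1"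
proof -
  let ?b = "\<lambda>l. \<Prod>k\<in>S - {l}. [:- k, 1:] ^ m k" and ?c = "\<Prod>l\<in>S. [:- l, 1:] ^ m l"
  have iff: "1 / poly ?c z = (\<Sum>l\<in>S. poly (a l) z / (z - l) ^ m l) \<longleftrightarrow> poly (\<Sum>l\<in>S. a l * ?b l) z = 1"
    if z: "z \<notin> S" for z
  proof -
    have c0: "poly ?c z \<noteq> 0" using z assms by (auto simp: poly_prod)
    have "(\<Sum>l\<in>S. poly (a l) z / (z - l) ^ m l) * poly ?c z = (\<Sum>l\<in>S. poly (a l) z * poly (?b l) z)"
      unfolding sum_distrib_right
    proof (intro sum.cong refl)
      fix l assume l: "l \<in> S"
      have "poly ?c z = (z - l) ^ m l * poly (?b l) z"
        by (subst prod_linear_powers_remove[OF assms l]) simp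
      moreover have "z \<noteq> l" using z l by auto
      ultimately show "poly (a l) z / (z - l) ^ m l * poly ?c z = poly (a l) z * poly (?b l) z" by simp
    qed
    then show ?thesis using c0 by (simp add: poly_sum divide_eq_eq)
  qed
  show ?thesis
  proof
    assume *: "\<forall>z. z \<notin> S \<longrightarrow> 1 / poly ?c z = (\<Sum>l\<in>S. poly (a l) z / (z - l) ^ m l)"
    show "(\<Sum>l\<in>S. a l * ?b l) = 1"
    proof (rule ccontr)
      assume "(\<Sum>l\<in>S. a l * ?b l) \<noteq> 1"
      then have "finite {z. poly ((\<Sum>l\<in>S. a l * ?b l) - 1) z = 0}" by (intro poly_roots_finite) simp
      moreover have "- S \<subseteq> {z. poly ((\<Sum>l\<in>S. a l * ?b l) - 1) z = 0}"
        using * iff by auto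
      ultimately have "finite (- S)" by (rule rev_finite_subset)
      then show False using assms finite_compl infinite_UNIV_char_0 by blast
    qed
  next
    assume "(\<Sum>l\<in>S. a l * ?b l) = 1"
    then show "\<forall>z. z \<notin> S \<longrightarrow> 1 / poly ?c z = (\<Sum>l\<in>S. poly (a l) z / (z - l) ^ m l)"
      using iff by simp
  qed
qed

text \<open>A resolution of unity: evaluated at \<open>M\<close>, it says that the spectral
  projections add up to the identity matrix.\<close>

lemma sum_pf_numerators_cofactor: "(\<Sum>l\<in>eigenvalues M. pf_numerators M l * pf_cofactor M l) = 1"
proof -
  let ?S = "eigenvalues M" and ?m = "alg_mult M"
  define P where "P a \<longleftrightarrow> (\<forall>l. l \<notin> ?S \<longrightarrow> a l = 0) \<and> (\<forall>l\<in>?S. degree (a l) < ?m l) \<and>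
    (\<Sum>l\<in>?S. a l * (\<Prod>k\<in>?S - {l}. [:- k, 1:] ^ ?m k)) = 1" for a
  have "pf_numerators M = (THE a. P a)"
    unfolding pf_numerators_def char_polynomial_decompose[of M]
      partial_fractions_function_iff[OF finite_eigenvalues] P_def ..
  moreover have "\<exists>!a. P a"
  proof -
    have pos: "\<And>l. l \<in> ?S \<Longrightarrow> 0 < ?m l" by (rule alg_mult_pos)
    have "\<exists>a. P a"
      by (rule partial_fractions_exist[OF finite_eigenvalues eigenvalues_nonempty pos])
        (auto simp: P_def)
    then obtain a where "P a" by blast
    moreover have "a' = a" if "P a'" for a'
    proof
      fix l
      show "a' l = a l"
        using that \<open>P a\<close> partial_fractions_unique[OF finite_eigenvalues[of M], of a' ?m a l]
        by (cases "l \<in> ?S") (auto simp: P_def)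
    qed
    ultimately show ?thesis by blast
  qed
  ultimately have "P (pf_numerators M)" using theI'[of P] by simp
  then show ?thesis by (simp add: P_def pf_cofactor_def)
qed

lemma truncated_product_dvd:
  fixes a b :: "nat \<Rightarrow> 'a::comm_ring_1"
  shows "y ^ n dvd (\<Sum>i<n. a i * y ^ i) * (\<Sum>j<n. b j * y ^ j) - (\<Sum>k<n. (\<Sum>i\<le>k. a i * b (k - i)) * y ^ k)"
proof -
  let ?g = "\<lambda>(i, j). a i * b j * y ^ (i + j)"
  have "(\<Sum>i<n. a i * y ^ i) * (\<Sum>j<n. b j * y ^ j) = sum ?g ({..<n} \<times> {..<n})"
    by (simp add: sum_product sum.cartesian_product power_add mult_ac)
  \<comment> \<open>The pairs below the antidiagonal form the truncated Cauchy product; every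
    remaining term carries a factor \<open>y ^ n\<close>.\<close>
  also have "\<dots> = sum ?g {(i, j). i + j < n} + sum ?g ({..<n} \<times> {..<n} - {(i, j). i + j < n})"
    by (subst add.commute, rule sum.subset_diff) auto
  also have "sum ?g {(i, j). i + j < n} = (\<Sum>k<n. (\<Sum>i\<le>k. a i * b (k - i)) * y ^ k)"
    by (subst sum.triangle_reindex) (simp add: sum_distrib_right)
  finally have "(\<Sum>i<n. a i * y ^ i) * (\<Sum>j<n. b j * y ^ j) - (\<Sum>k<n. (\<Sum>i\<le>k. a i * b (k - i)) * y ^ k) =
      sum ?g ({..<n} \<times> {..<n} - {(i, j). i + j < n})"
    by simp
  moreover have "y ^ n dvd sum ?g ({..<n} \<times> {..<n} - {(i, j). i + j < n})"
    by (intro dvd_sum) (auto intro!: dvd_mult le_imp_power_dvd)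
  ultimately show ?thesis by simp
qed

text \<open>\<open>local_power l n r\<close> is the Taylor polynomial of degree below \<open>n\<close> of \<open>z powr r\<close> at \<open>l\<close>.\<close>

definition local_power :: "complex \<Rightarrow> nat \<Rightarrow> real \<Rightarrow> complex poly" where
  "local_power l n r =
     smult (l powr of_real r) (\<Sum>j<n. [:of_real r gchoose j:] * smult (1 / l) [:- l, 1:] ^ j)"

lemma linear_power_dvd_scaled: "[:- l, 1:] ^ n dvd smult (1 / l) [:- l, 1:] ^ n" for l :: complex
  by (intro dvd_power_same dvd_smult dvd_refl)

text \<open>With x = l (1 + y), the sum in \<open>local_power\<close> is the binomial series of (1 +
  y)^r cut off at y^n. Its Cauchy product obeys Vandermonde's identity, and for fixed
  \<open>l \<noteq> 0\<close> the principal value is multiplicative in the exponent.\<close>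

lemma local_power_add:
  assumes "l \<noteq> 0"
  shows "[:- l, 1:] ^ n dvd local_power l n r * local_power l n s - local_power l n (r + s)"
proof -
  let ?y = "smult (1 / l) [:- l, 1:]"
  let ?S = "\<lambda>r. \<Sum>j<n. [:of_real r gchoose j:] * ?y ^ j"
  have "(\<Sum>i\<le>k. [:f i:] * [:g i:]) = [:\<Sum>i\<le>k. f i * g i:]" for f g :: "nat \<Rightarrow> complex" and k
    by (induction k) simp_all
  then have "(\<Sum>i\<le>k. [:of_real r gchoose i:] * [:of_real s gchoose (k - i):]) =
      [:(of_real (r + s) :: complex) gchoose k:]" for k
    using gbinomial_Vandermonde[of "of_real r :: complex" "of_real s" k] by (simp only: atLeast0AtMost of_real_add)
  then have "?y ^ n dvd ?S r * ?S s - ?S (r + s)"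
    using truncated_product_dvd[of ?y n "\<lambda>i. [:of_real r gchoose i:]" "\<lambda>i. [:of_real s gchoose i:]"] by simp
  then have dvd: "[:- l, 1:] ^ n dvd ?S r * ?S s - ?S (r + s)"
    using linear_power_dvd_scaled dvd_trans by blast
  have "local_power l n r * local_power l n s - local_power l n (r + s) =
      smult (l powr of_real (r + s)) (?S r * ?S s - ?S (r + s))"
    by (simp add: local_power_def powr_add smult_diff_right mult.commute)
  then show ?thesis using dvd by (simp add: dvd_smult)
qed

lemma local_power_0:
  assumes "l \<noteq> 0" "0 < n"
  shows "local_power l n 0 = 1"
proof -
  have "(\<Sum>j<n. [:of_real 0 gchoose j:] * smult (1 / l) [:- l, 1:] ^ j) = (\<Sum>j<n. if j = 0 then 1 else 0)"
    by (intro sum.cong refl) (simp add: gbinomial_0_left)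
  then show ?thesis using assms by (simp only: local_power_def) simp
qed

text \<open>For exponent 1 the binomial series is 1 + y, so for \<open>n \<ge> 2\<close> the
  polynomial is exactly l (1 + y) = x. For \<open>n = 1\<close> it is cut down to the constant
  \<open>l\<close>, which agrees with x only modulo x - l.\<close>

lemma local_power_1:
  assumes "l \<noteq> 0" "0 < n"
  shows "[:- l, 1:] ^ n dvd local_power l n 1 - [:0, 1:]"
proof (cases "n = 1")
  case True
  have eq: "local_power l 1 1 - [:0, 1:] = - [:- l, 1:]" using assms(1) by (simp add: local_power_def)
  show ?thesis unfolding True eq power_one_right dvd_minus_iff by (rule dvd_refl)
next
  case False
  define m where "m = n - 2"
  then have n: "n = Suc (Suc m)" using assms(2) False by arith
  have "(1 :: complex) gchoose Suc (Suc j) = 0" for j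
    using binomial_gbinomial[of 1 "Suc (Suc j)", where 'a = complex] by simp
  then have "local_power l n 1 = [:0, 1:]"
    using assms(1) by (simp add: local_power_def n sum.lessThan_Suc_shift one_pCons del: sum.lessThan_Suc pCons_one)
  then show ?thesis by simp
qed

text \<open>\<open>mat_rpower\<close> read in the indeterminate: the Chinese remainder interpolant
  of the local powers, with the summands of the resolution of unity as idempotents.\<close>

definition power_poly :: "complex^'n^'n \<Rightarrow> real \<Rightarrow> complex poly" where
  "power_poly M r = (\<Sum>l\<in>eigenvalues M. pf_numerators M l * pf_cofactor M l * local_power l (alg_mult M l) r)"

lemma mat_rpower_eq_mat_poly:
  fixes M :: "complex^'n^'n"
  shows "mat_rpower M r = mat_poly (power_poly M r) M"
proof -
  have "mat_poly (smult (1 / l) [:- l, 1:]) M = mat (1 / l) ** (M - mat l)" for l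
  proof -
    have "mat (- l) = (- mat l :: complex^'n^'n)" by (simp add: mat_def vec_eq_iff)
    then show ?thesis unfolding mat_poly_smult by (simp add: mat_poly_pCons)
  qed
  then show ?thesis
    by (simp del: smult_pCons mult_smult_right add: mat_rpower_def power_poly_def local_power_def spectral_proj_def mat_poly_sum mat_poly_mult
        mat_poly_smult mat_poly_power matrix_mul_assoc)
qed

text \<open>The weight \<open>?e l\<close> is 1 modulo the linear power at \<open>l\<close>, and all
  other weights are 0 modulo it, because their cofactors contain that factor.\<close>

lemma power_poly_cong_local_power:
  assumes "l \<in> eigenvalues M"
  shows "[:- l, 1:] ^ alg_mult M l dvd power_poly M r - local_power l (alg_mult M l) r"
proof -
  let ?S = "eigenvalues M" and ?pw = "[:- l, 1:] ^ alg_mult M l"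
  let ?e = "\<lambda>l. pf_numerators M l * pf_cofactor M l" and ?L = "\<lambda>l. local_power l (alg_mult M l) r"
  have other: "?pw dvd ?e k" if "k \<in> ?S - {l}" for k
    unfolding pf_cofactor_def using that assms
    by (intro dvd_mult linear_power_dvd_cofactor finite_eigenvalues) auto
  have "?e l - 1 = - (\<Sum>k\<in>?S - {l}. ?e k)"
    using sum_pf_numerators_cofactor[of M] sum.remove[OF finite_eigenvalues assms, of ?e]
    by (simp add: algebra_simps)
  moreover have "?pw dvd (\<Sum>k\<in>?S - {l}. ?e k)"
    using other by (rule dvd_sum)
  ultimately have "?pw dvd ?e l - 1" by (simp only: dvd_minus_iff)
  moreover have "power_poly M r - ?L l = (?e l - 1) * ?L l + (\<Sum>k\<in>?S - {l}. ?e k * ?L k)"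
    unfolding power_poly_def sum.remove[OF finite_eigenvalues assms] by (simp add: algebra_simps)
  moreover have "?pw dvd (\<Sum>k\<in>?S - {l}. ?e k * ?L k)"
    by (intro dvd_sum dvd_mult2[OF other])
  ultimately show ?thesis by simp
qed

lemma mat_poly_cong:
  assumes "\<And>l. l \<in> eigenvalues M \<Longrightarrow> [:- l, 1:] ^ alg_mult M l dvd p - q"
  shows "mat_poly p M = mat_poly q M"
proof -
  have "char_polynomial M dvd p - q"
    using prod_linear_powers_dvd[OF finite_eigenvalues[of M] assms] by (simp flip: char_polynomial_decompose)
  then obtain k where "p - q = char_polynomial M * k" ..
  then have "p = q + char_polynomial M * k" by (simp add: algebra_simps)
  then show ?thesis by (simp add: mat_poly_add mat_poly_mult Cayley_Hamilton)
qed

lemma mat_rpower_add: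
  assumes "invertible M"
  shows "mat_rpower M (r + s) = mat_rpower M r ** mat_rpower M s"
proof -
  have "[:- l, 1:] ^ alg_mult M l dvd power_poly M (r + s) - power_poly M r * power_poly M s"
    if l: "l \<in> eigenvalues M" for l
  proof -
    let ?L = "local_power l (alg_mult M l)" and ?u = "power_poly M"
    note cong = power_poly_cong_local_power[OF l]
    \<comment> \<open>Each difference on the right is divisible: the first three contain
      interpolation errors, the last is the local group law.\<close>
    have eq: "?u (r + s) - ?u r * ?u s = (?u (r + s) - ?L (r + s)) - (?u r - ?L r) * ?u s -
        ?L r * (?u s - ?L s) - (?L r * ?L s - ?L (r + s))"
      by (simp add: algebra_simps)
    show ?thesis
      unfolding eq by (intro dvd_diff dvd_mult2[OF cong] dvd_mult[OF cong] cong
          local_power_add eigenvalue_nonzero[OF assms l])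
  qed
  then show ?thesis
    unfolding mat_rpower_eq_mat_poly mat_poly_mult[symmetric] by (rule mat_poly_cong)
qed

lemma mat_rpower_0:
  assumes "invertible M"
  shows "mat_rpower M 0 = mat 1"
proof -
  have "mat_poly (power_poly M 0) M = mat_poly 1 M"
  proof (rule mat_poly_cong)
    fix l assume l: "l \<in> eigenvalues M"
    show "[:- l, 1:] ^ alg_mult M l dvd power_poly M 0 - 1"
      using power_poly_cong_local_power[OF l, of 0] local_power_0[OF eigenvalue_nonzero[OF assms l] alg_mult_pos[OF l]]
      by simp
  qed
  then show ?thesis by (simp add: mat_rpower_eq_mat_poly)
qed

lemma mat_rpower_1:
  assumes "invertible M"
  shows "mat_rpower M 1 = M"
proof -
  have "mat_poly (power_poly M 1) M = mat_poly [:0, 1:] M"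
  proof (rule mat_poly_cong)
    fix l assume l: "l \<in> eigenvalues M"
    show "[:- l, 1:] ^ alg_mult M l dvd power_poly M 1 - [:0, 1:]"
      using dvd_add[OF power_poly_cong_local_power[OF l, of 1]
          local_power_1[OF eigenvalue_nonzero[OF assms l] alg_mult_pos[OF l]]]
      by (simp only: add_diff_eq diff_add_cancel)
  qed
  then show ?thesis by (simp add: mat_rpower_eq_mat_poly mat_poly_pCons mat_def[of 0] flip: zero_vec_def)
qed

section \<open>Differentiability of real powers\<close>

lemma bounded_bilinear_matrix_matrix_mult:
  "bounded_bilinear ((**) :: complex^'n^'m \<Rightarrow> complex^'k^'n \<Rightarrow> complex^'k^'m)"
proof -
  have "bilinear ((**) :: complex^'n^'m \<Rightarrow> complex^'k^'n \<Rightarrow> complex^'k^'m)"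
    unfolding bilinear_def
    by (auto intro!: linearI simp: vec_eq_iff matrix_matrix_mult_def scaleR_sum_right distrib_left distrib_right
        sum.distrib)
  then show ?thesis by (simp add: bilinear_conv_bounded_bilinear)
qed

lemma bounded_linear_mat: "bounded_linear (mat :: complex \<Rightarrow> complex^'n^'n)"
proof -
  have "linear (mat :: complex \<Rightarrow> complex^'n^'n)"
    by (rule linearI) (auto simp: vec_eq_iff mat_def)
  then show ?thesis by (simp add: linear_conv_bounded_linear)
qed

lemma differentiable_of_field_derivative:
  fixes f :: "complex \<Rightarrow> complex" and r :: real
  assumes "f field_differentiable at (of_real r)"
  shows "(\<lambda>r. f (of_real r)) differentiable at r"
proof -
  obtain D where "(f has_field_derivative D) (at (of_real r))"
    using assms by (auto simp: field_differentiable_def)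
  then show ?thesis
    using has_vector_derivative_real_field differentiableI_vector by blast
qed

text \<open>The exponent enters only through scalars, namely \<open>l powr r\<close> and the
  binomial coefficients, which are polynomials in \<open>r\<close>; all matrix factors are
  constant.\<close>

lemma mat_rpower_differentiable:
  fixes M :: "complex^'n^'n"
  assumes "invertible M"
  shows "mat_rpower M differentiable at r"
proof -
  have mult: "(\<lambda>x. f x ** g x) differentiable at r" if "f differentiable at r" "g differentiable at r"
    for f g :: "real \<Rightarrow> complex^'n^'n"
    using that bounded_bilinear.FDERIV[OF bounded_bilinear_matrix_matrix_mult] unfolding differentiable_def by blast
  have mat: "(\<lambda>x. mat (f x) :: complex^'n^'n) differentiable at r" if "f differentiable at r" for f
    using that bounded_linear.has_derivative[OF bounded_linear_mat] unfolding differentiable_def by blast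
  have powr: "(\<lambda>x. l powr complex_of_real x) differentiable at r" if "l \<in> eigenvalues M" for l
  proof (rule differentiable_of_field_derivative)
    have "((\<lambda>z. l powr z) has_field_derivative Ln l * l powr (of_real r)) (at (of_real r))"
      using eigenvalue_nonzero[OF assms that] by (rule has_field_derivative_powr_right)
    then show "(\<lambda>z. l powr z) field_differentiable at (of_real r)" by (auto simp: field_differentiable_def)
  qed
  have choose: "(\<lambda>x. complex_of_real x gchoose j) differentiable at r" for j
  proof (rule differentiable_of_field_derivative)
    have "(\<lambda>z::complex. z gchoose j) holomorphic_on UNIV"
      unfolding gbinomial_prod_rev by (intro holomorphic_intros) auto
    then show "(\<lambda>z::complex. z gchoose j) field_differentiable at (of_real r)"
      by (simp add: holomorphic_on_def)
  qed
  show ?thesis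
    unfolding mat_rpower_def[abs_def]
    by (intro differentiable_sum mult mat powr choose differentiable_const finite_eigenvalues ballI) auto
qed

section \<open>Graininess and periodicity\<close>

lemma graininess_bounds:
  assumes "closed T" "s \<in> T" "t < s"
  shows "0 \<le> ts_mu T t" "ts_mu T t \<le> s - t"
  using ts_sigma_props[of T t] assms by (auto simp: ts_mu_def)

lemma graininess_tendsto_left:
  assumes "closed T" "t \<in> T"
  shows "(ts_mu T \<longlongrightarrow> 0) (at t within T \<inter> {..<t})"
proof (rule real_tendsto_sandwich)
  have "0 \<le> ts_mu T s \<and> ts_mu T s \<le> t - s" if "s < t" for s
    using graininess_bounds[of T t s] assms that by auto
  then show "\<forall>\<^sub>F s in at t within T \<inter> {..<t}. 0 \<le> ts_mu T s"
    "\<forall>\<^sub>F s in at t within T \<inter> {..<t}. ts_mu T s \<le> t - s"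
    by (auto simp: eventually_at_filter intro!: always_eventually)
  have "((\<lambda>s. t - s) \<longlongrightarrow> t - t) (at t within T \<inter> {..<t})" by (intro tendsto_intros)
  then show "((\<lambda>s. t - s) \<longlongrightarrow> 0) (at t within T \<inter> {..<t})" by simp
qed simp

text \<open>Left of \<open>t\<close> the successor of a point is capped by \<open>t\<close> itself;
  from \<open>t\<close> on it is capped by a point \<open>q\<close> of \<open>T\<close> close above
  \<open>t\<close>, supplied by right-density.\<close>

lemma graininess_tendsto_dense:
  assumes "closed T" "t \<in> T" "\<forall>t\<in>T. \<exists>s\<in>T. t < s" "ts_sigma T t = t"
  shows "(ts_mu T \<longlongrightarrow> 0) (at t within T)"
proof (rule tendstoI)
  fix e :: real assume "0 < e"
  obtain q where q: "q \<in> T" "t < q" "q < t + e"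
    using ts_sigma_dense[of T t e] assms \<open>0 < e\<close> by blast
  have "dist (ts_mu T s) 0 < e" if "s \<in> T" "s \<noteq> t" "dist s t < q - t" for s
  proof (cases "s < t")
    case True
    then show ?thesis
      using graininess_bounds[of T t s] assms that q by (auto simp: dist_real_def)
  next
    case False
    then show ?thesis
      using graininess_bounds[of T q s] assms that q by (auto simp: dist_real_def)
  qed
  then show "\<forall>\<^sub>F s in at t within T. dist (ts_mu T s) 0 < e"
    unfolding eventually_at using q by (intro exI[of _ "q - t"]) auto
qed

text \<open>At left-dense points the left limit is \<open>g 0\<close>, whatever the graininess at
  the point itself. If such a point is right-scattered, its value may differ, so rd-continuity
  rather than continuity is the right claim.\<close>

lemma rd_continuous_graininess:
  fixes g :: "real \<Rightarrow> 'a::real_normed_vector"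
  assumes "closed T" "\<forall>t\<in>T. \<exists>s\<in>T. t < s" "continuous_on UNIV g"
  shows "rd_continuous T (\<lambda>t. g (ts_mu T t))"
proof -
  have g0: "isCont g 0" using assms(3) by (simp add: continuous_on_eq_continuous_at)
  have "continuous (at t within T) (\<lambda>t. g (ts_mu T t))" if "t \<in> T" "ts_sigma T t = t" for t
    using isCont_tendsto_compose[OF g0 graininess_tendsto_dense[OF assms(1) that(1) assms(2) that(2)]] that
    by (simp add: continuous_within ts_mu_def)
  moreover have "((\<lambda>t. g (ts_mu T t)) \<longlongrightarrow> g 0) (at t within T \<inter> {..<t})" if "t \<in> T" for t
    using isCont_tendsto_compose[OF g0 graininess_tendsto_left[OF assms(1) that]] .
  ultimately show ?thesis unfolding rd_continuous_def by blast
qed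

text \<open>If \<open>u - p\<close> fell into a gap of \<open>T\<close> starting at
  \<open>a\<close>, periodicity would copy the gap with equal length to \<open>a + p\<close>, and
  the copy would contain \<open>u\<close> in its interior. The point \<open>s\<close> guarantees
  that there is something of \<open>T\<close> below \<open>u - p\<close> for the gap to start
  from.\<close>

lemma ts_periodic_shift_back:
  assumes "0 < p" "closed T" "ts_periodic p T" "s \<in> T" "u \<in> T" "s \<le> u - p"
  shows "u - p \<in> T"
proof (rule ccontr)
  assume notin: "u - p \<notin> T"
  let ?A = "T \<inter> {..u - p}"
  define a where "a = Sup ?A"
  have bdd: "bdd_above ?A" by (auto intro: bdd_aboveI[of _ "u - p"])
  have "a \<in> ?A"
    unfolding a_def using assms bdd by (intro closed_contains_Sup closed_Int) auto
  then have a: "a \<in> T" "a < u - p" using notin by (auto simp: order_less_le)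
  have up: "\<exists>s\<in>T. a < s" using assms(5) a assms(1) by (intro bexI[of _ u]) auto
  have sig: "u - p < ts_sigma T a"
  proof (rule ccontr)
    assume "\<not> u - p < ts_sigma T a"
    then have le: "ts_sigma T a \<le> u - p" by simp
    then have "ts_sigma T a \<le> a"
      using ts_sigma_props(1)[OF assms(2) up] bdd unfolding a_def by (intro cSup_upper) auto
    then have "ts_sigma T a = a" using ts_sigma_props(2)[OF assms(2) up] by simp
    then obtain r where r: "r \<in> T" "a < r" "r < a + (u - p - a)"
      using ts_sigma_dense[OF up] a by (metis diff_gt_0_iff_gt)
    then have "r \<le> a" unfolding a_def using bdd by (intro cSup_upper) auto
    then show False using r by simp
  qed
  have "a + p \<in> T" "ts_mu T (a + p) = ts_mu T a"
    using assms(3) a by (auto simp: ts_periodic_def)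
  moreover have "ts_mu T (a + p) \<le> u - (a + p)"
    using graininess_bounds(2)[OF assms(2,5)] a by simp
  ultimately show False using sig by (simp add: ts_mu_def)
qed

text \<open>Points right of \<open>t0\<close> are pulled back period by period into
  \<open>[t0, t0 + p]\<close>, which is possible since \<open>t0\<close> stays below them. Points
  left of \<open>t0\<close> are first pushed forward past \<open>t0\<close>, which preserves their
  graininess.\<close>

lemma ts_periodic_graininess_constant:
  assumes "0 < p" "closed T" "ts_periodic p T" "t0 \<in> T"
    and c: "\<forall>t\<in>{t0..t0 + p} \<inter> T. ts_mu T t = c" and "t \<in> T"
  shows "ts_mu T t = c"
proof -
  have per: "t + p \<in> T" "ts_mu T (t + p) = ts_mu T t" if "t \<in> T" for t
    using assms(3) that by (auto simp: ts_periodic_def)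
  have right: "ts_mu T t = c" if "t \<in> T" "t0 \<le> t" "t \<le> t0 + real (Suc n) * p" for t n
    using that
  proof (induction n arbitrary: t)
    case 0
    then show ?case using c by simp
  next
    case (Suc n)
    show ?case
    proof (cases "t \<le> t0 + p")
      case True then show ?thesis using c Suc by simp
    next
      case False
      then have "t - p \<in> T" using ts_periodic_shift_back[OF assms(1-4), of t] Suc by simp
      moreover have "t - p \<le> t0 + real (Suc n) * p"
        using Suc.prems by (simp add: algebra_simps)
      ultimately show ?thesis using Suc.IH[of "t - p"] per[of "t - p"] False by simp
    qed
  qed
  have shift: "t + real n * p \<in> T \<and> ts_mu T (t + real n * p) = ts_mu T t" for n
  proof (induction n)
    case (Suc n)
    then show ?case using per[of "t + real n * p"] by (simp add: algebra_simps)
  qed (use \<open>t \<in> T\<close> in simp)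
  obtain n where n: "t0 - t < real n * p" using reals_Archimedean3[OF assms(1)] by blast
  obtain k where k: "t + real n * p - t0 < real k * p" using reals_Archimedean3[OF assms(1)] by blast
  have "ts_mu T (t + real n * p) = c"
    using shift[of n] n k assms(1) by (intro right[of _ k]) (auto simp: algebra_simps)
  then show ?thesis using shift[of n] by simp
qed

section \<open>One-parameter groups of matrices on a time scale\<close>

interpretation matrix_mult: bounded_bilinear "(**) :: complex^'n^'n \<Rightarrow> complex^'n^'n \<Rightarrow> complex^'n^'n"
  by (rule bounded_bilinear_matrix_matrix_mult)

text \<open>All that the time scale argument uses about the powers of \<open>M\<close>. A derivative
  at 0 suffices, since the group law transports it to every point.\<close>

locale one_parameter_group =
  fixes V :: "real \<Rightarrow> complex^'n^'n" and D :: "complex^'n^'n"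
  assumes add: "V (x + y) = V x ** V y"
    and zero: "V 0 = mat 1"
    and deriv0: "(V has_vector_derivative D) (at 0)"
begin

lemma deriv: "(V has_vector_derivative D ** V x) (at x)"
proof -
  have "((\<lambda>y. y - x) has_vector_derivative 1) (at x)"
    by (auto intro!: derivative_eq_intros)
  then have "(V \<circ> (\<lambda>y. y - x) has_vector_derivative 1 *\<^sub>R D) (at x)"
    by (rule vector_diff_chain_at) (simp add: deriv0)
  then have "((\<lambda>y. V (y - x) ** V x) has_vector_derivative D ** V x) (at x)"
    using matrix_mult.bounded_linear_left[THEN bounded_linear.has_vector_derivative] by (auto simp: o_def)
  then show ?thesis by (simp flip: add)
qed

lemma continuous: "isCont V x"
  using deriv has_vector_derivative_continuous by blast

lemma commute: "V x ** V y = V y ** V x"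
  by (metis add add.commute)

lemma inverse: "V (- x) ** V x = mat 1" "V x ** V (- x) = mat 1"
  by (simp_all add: zero flip: add)

text \<open>For \<open>V x\<close> = exp (x D) this is Hilger's inverse cylinder transformation of
  \<open>D\<close> with step \<open>m\<close>. The value at 0 is the limit, which makes the function
  continuous on the whole line.\<close>

definition quotient :: "real \<Rightarrow> complex^'n^'n" where
  "quotient m = (if m = 0 then D else (V m - mat 1) /\<^sub>R m)"

lemma quotient_scaleR: "m *\<^sub>R quotient m = V m - mat 1"
  by (simp add: quotient_def zero)

lemma quotient_tendsto_0: "((\<lambda>m. (V m - mat 1) /\<^sub>R m) \<longlongrightarrow> D) (at 0)"
proof -
  have "((\<lambda>y. norm (V y - V 0 - (y - 0) *\<^sub>R D) / norm (y - 0)) \<longlongrightarrow> 0) (at 0)"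
    using deriv0 unfolding has_vector_derivative_def has_derivative_iff_norm by blast
  moreover have "\<forall>\<^sub>F y in at 0. norm (V y - V 0 - (y - 0) *\<^sub>R D) / norm (y - 0) =
      norm ((V y - mat 1) /\<^sub>R y - D)"
  proof -
    have "norm (V y - V 0 - (y - 0) *\<^sub>R D) / norm (y - 0) = norm ((V y - mat 1) /\<^sub>R y - D)" if "y \<noteq> 0" for y
    proof -
      have "(V y - mat 1) /\<^sub>R y - D = (V y - V 0 - (y - 0) *\<^sub>R D) /\<^sub>R y"
        using that by (simp add: zero scaleR_diff_right)
      then show ?thesis by (simp only: norm_scaleR) (simp add: divide_inverse_commute)
    qed
    then show ?thesis by (auto simp: eventually_at_filter)
  qed
  ultimately have "((\<lambda>y. norm ((V y - mat 1) /\<^sub>R y - D)) \<longlongrightarrow> 0) (at 0)"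
    by (rule Lim_transform_eventually)
  then show ?thesis using tendsto_norm_zero_iff LIM_zero_iff by blast
qed

lemma continuous_quotient: "continuous_on UNIV quotient"
  unfolding continuous_on_eq_continuous_at[OF open_UNIV]
proof
  fix m :: real
  have ev: "\<forall>\<^sub>F x in at m. (V x - mat 1) /\<^sub>R x = quotient x"
  proof -
    have "\<forall>\<^sub>F x in at m. x \<noteq> 0"
    proof (cases "m = 0")
      case False
      then have "\<forall>\<^sub>F x in at m. x \<in> - {0}" by (intro eventually_at_in_open') auto
      then show ?thesis by simp
    qed (simp add: eventually_neq_at_within)
    then show ?thesis by eventually_elim (simp add: quotient_def)
  qed
  have "((\<lambda>m. (V m - mat 1) /\<^sub>R m) \<longlongrightarrow> quotient m) (at m)"
  proof (cases "m = 0")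
    case True
    then show ?thesis using quotient_tendsto_0 by (simp add: quotient_def)
  next
    case False
    have "((\<lambda>m. (V m - mat 1) /\<^sub>R m) \<longlongrightarrow> (V m - mat 1) /\<^sub>R m) (at m)"
      using continuous[of m] False by (intro tendsto_intros) (auto simp: isCont_def)
    then show ?thesis using False by (simp add: quotient_def)
  qed
  then show "isCont quotient m"
    unfolding isCont_def by (rule Lim_transform_eventually[OF _ ev])
qed

text \<open>For \<open>m = 0\<close> the assumed identity is differentiated at 0. Used twice, once
  with a group element and once with a quotient as \<open>B\<close>, it makes all quotients
  commute.\<close>

lemma commute_quotient:
  assumes "\<And>x. B ** V x = V x ** B"
  shows "B ** quotient m = quotient m ** B"
proof (cases "m = 0")
  case True
  have "((\<lambda>x. B ** V x) has_vector_derivative B ** D) (at 0)"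
    using matrix_mult.bounded_linear_right deriv0 by (rule bounded_linear.has_vector_derivative)
  moreover have "((\<lambda>x. V x ** B) has_vector_derivative D ** B) (at 0)"
    using matrix_mult.bounded_linear_left deriv0 by (rule bounded_linear.has_vector_derivative)
  ultimately show ?thesis
    using True assms by (auto simp: quotient_def intro: vector_derivative_unique_at)
next
  case False
  then show ?thesis
    by (simp add: quotient_def matrix_mult.scaleR_left matrix_mult.scaleR_right matrix_mult.diff_left
        matrix_mult.diff_right assms)
qed

lemma quotient_commute: "quotient m ** quotient n = quotient n ** quotient m"
  by (metis commute commute_quotient)

context
  fixes T :: "real set"
  assumes T: "closed T" "\<forall>t\<in>T. \<exists>s\<in>T. t < s"
begin

text \<open>Here I + \<mu> R is the group element \<open>V\<close> at the graininess, whose inverse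
  is \<open>V\<close> at the negative graininess.\<close>

lemma regressive: "ts_regressive T (\<lambda>t. quotient (ts_mu T t))"
proof -
  have "invertible (V m)" for m using inverse by (auto simp: invertible_def)
  then show ?thesis
    unfolding ts_regressive_def quotient_scaleR
    using rd_continuous_graininess[OF T continuous_quotient] by simp
qed

text \<open>The commutator with the fixed matrix \<open>B\<close> is a bounded linear map
  \<open>L\<close> that kills every value of \<open>R\<close>. Applied to an antiderivative it has
  zero delta derivative, hence kills all increments, which are the integrals.\<close>

lemma commutes_with_integral: "commutes_with_delta_integral T (\<lambda>t. quotient (ts_mu T t))"
  unfolding commutes_with_delta_integral_def
proof (intro ballI)
  fix s t assume "s \<in> T" "t \<in> T"
  obtain F where F: "\<forall>t\<in>T. has_delta_derivative T F (quotient (ts_mu T t)) t"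
    using graininess_antiderivative_exists[OF T continuous_quotient] by blast
  define B where "B = quotient (ts_mu T t)"
  define L where "L Y = B ** Y - Y ** B" for Y
  have "bounded_linear L"
    unfolding L_def by (intro bounded_linear_sub matrix_mult.bounded_linear_left matrix_mult.bounded_linear_right)
  have "\<forall>r\<in>T. has_delta_derivative T (\<lambda>x. L (F x)) 0 r"
  proof
    fix r assume "r \<in> T"
    then have "has_delta_derivative T (\<lambda>x. L (F x)) (L (quotient (ts_mu T r))) r"
      using T(2) F by (intro has_delta_derivative_bounded_linear[OF T(1) _ _ \<open>bounded_linear L\<close>]) auto
    moreover have "L (quotient (ts_mu T r)) = 0"
      unfolding L_def B_def by (rule eq_iff_diff_eq_0[THEN iffD1, OF quotient_commute])
    ultimately show "has_delta_derivative T (\<lambda>x. L (F x)) 0 r" by simp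
  qed
  then have "L (F t) = L (F s)"
    by (rule zero_delta_derivative_constant[OF T _ \<open>t \<in> T\<close> \<open>s \<in> T\<close>])
  then have "L (F t - F s) = 0"
    using linear_diff[OF bounded_linear.linear[OF \<open>bounded_linear L\<close>], of "F t" "F s"] by simp
  then show "quotient (ts_mu T t) ** delta_integral T (\<lambda>t. quotient (ts_mu T t)) s t =
      delta_integral T (\<lambda>t. quotient (ts_mu T t)) s t ** quotient (ts_mu T t)"
    unfolding delta_integral_eq[OF T F \<open>s \<in> T\<close> \<open>t \<in> T\<close>] L_def B_def
    by (rule eq_iff_diff_eq_0[THEN iffD2])
qed

lemma fundamental_solution:
  assumes "t0 \<in> T"
  shows "ts_fundamental_solution T (\<lambda>t. quotient (ts_mu T t)) t0 (\<lambda>t. if t \<in> T then V (t - t0) else 0)"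
proof -
  have "has_delta_derivative T (\<lambda>t. V (t - t0)) (quotient (ts_mu T t) ** V (t - t0)) t" if t: "t \<in> T" for t
  proof -
    have up: "\<exists>s\<in>T. t < s" using T t by blast
    have "((\<lambda>y. y - t0) has_vector_derivative 1) (at t)"
      by (auto intro!: derivative_eq_intros)
    from vector_diff_chain_at[OF this deriv]
    have d: "((\<lambda>t. V (t - t0)) has_vector_derivative D ** V (t - t0)) (at t)" by (simp add: o_def)
    show ?thesis
      unfolding has_delta_derivative_iff[OF T(1) t up]
    proof (intro conjI impI)
      have "ts_mu T t *\<^sub>R (quotient (ts_mu T t) ** V (t - t0)) = (V (ts_mu T t) - mat 1) ** V (t - t0)"
        by (simp flip: matrix_mult.scaleR_left add: quotient_scaleR)
      also have "\<dots> = V (ts_sigma T t - t0) - V (t - t0)"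
        by (simp add: matrix_mult.diff_left ts_mu_def flip: add)
      finally show "V (ts_sigma T t - t0) - V (t - t0) = ts_mu T t *\<^sub>R (quotient (ts_mu T t) ** V (t - t0))" ..
      show "continuous (at t within T) (\<lambda>t. V (t - t0))"
        using d has_vector_derivative_continuous continuous_at_imp_continuous_at_within by blast
      assume "ts_sigma T t = t"
      then have "quotient (ts_mu T t) = D" by (simp add: ts_mu_def quotient_def)
      then show "((\<lambda>t. V (t - t0)) has_vector_derivative quotient (ts_mu T t) ** V (t - t0)) (at t within T)"
        using d by (simp add: has_vector_derivative_at_within)
    qed
  qed
  \<comment> \<open>Delta derivatives see only values on \<open>T\<close>, so the normalisation to 0
    outside does no harm.\<close>
  then have "has_delta_derivative T (\<lambda>t. if t \<in> T then V (t - t0) else 0) (quotient (ts_mu T t) ** V (t - t0)) t"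
    if "t \<in> T" for t
    using T(2) that
    by (subst has_delta_derivative_cong[OF T(1) that, where g = "\<lambda>t. V (t - t0)"]) auto
  then show ?thesis
    using assms by (simp add: ts_fundamental_solution_def ts_kappa_unbounded T zero)
qed

lemma fundamental_solution_unique:
  assumes "t0 \<in> T" and Y: "ts_fundamental_solution T (\<lambda>t. quotient (ts_mu T t)) t0 Y"
  shows "Y = (\<lambda>t. if t \<in> T then V (t - t0) else 0)"
proof -
  define Z where "Z t = V (t0 - t) ** Y t" for t
  have "has_delta_derivative T Z 0 t" if t: "t \<in> T" for t
  proof -
    have up: "\<exists>s\<in>T. t < s" using T t by blast
    let ?Q = "quotient (ts_mu T t)"
    have "has_delta_derivative T Y (?Q ** Y t) t"
      using Y t by (simp add: ts_fundamental_solution_def ts_kappa_unbounded T)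
    then have step: "Y (ts_sigma T t) - Y t = ts_mu T t *\<^sub>R (?Q ** Y t)"
      and cont: "continuous (at t within T) Y"
      and dense: "ts_sigma T t = t \<Longrightarrow> (Y has_vector_derivative ?Q ** Y t) (at t within T)"
      by (auto simp: has_delta_derivative_iff[OF T(1) t up])
    have "((\<lambda>y. t0 - y) has_vector_derivative - 1) (at t)"
      by (auto intro!: derivative_eq_intros)
    from vector_diff_chain_at[OF this deriv]
    have d: "((\<lambda>t. V (t0 - t)) has_vector_derivative - (D ** V (t0 - t))) (at t within T)"
      by (simp add: o_def has_vector_derivative_at_within)
    show ?thesis
      unfolding has_delta_derivative_iff[OF T(1) t up]
    proof (intro conjI impI)
      \<comment> \<open>Across a gap \<open>Y\<close> is multiplied by \<open>V (ts_mu T t)\<close>,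
        and the group law lets the factor \<open>V (t0 - ts_sigma T t)\<close> absorb exactly this
        jump.\<close>
      have "Y (ts_sigma T t) = Y t + (V (ts_mu T t) - mat 1) ** Y t"
        using step by (simp add: quotient_scaleR algebra_simps flip: matrix_mult.scaleR_left)
      then have "Y (ts_sigma T t) = V (ts_mu T t) ** Y t"
        by (simp add: matrix_mult.diff_left)
      then have "Z (ts_sigma T t) = Z t"
        by (simp add: Z_def matrix_mul_assoc ts_mu_def flip: add)
      then show "Z (ts_sigma T t) - Z t = ts_mu T t *\<^sub>R 0" by simp
      show "continuous (at t within T) Z"
        unfolding Z_def by (rule matrix_mult.continuous[OF has_vector_derivative_continuous[OF d] cont])
      assume right_dense: "ts_sigma T t = t"
      then have "?Q = D" by (simp add: ts_mu_def quotient_def)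
      \<comment> \<open>The product rule gives one term with \<open>D\<close> left of
        \<open>V\<close> and one with \<open>D\<close> right of it; they cancel only because the two
        commute.\<close>
      moreover have "V x ** D = D ** V x" for x
        using commute_quotient[of "V x" 0] commute by (simp add: quotient_def)
      ultimately show "(Z has_vector_derivative 0) (at t within T)"
        using matrix_mult.has_vector_derivative[OF d dense[OF right_dense]]
        by (simp add: Z_def[abs_def] matrix_mult.minus_left matrix_mul_assoc)
    qed
  qed
  then have "Z t = Z t0" if "t \<in> T" for t
    using zero_delta_derivative_constant[OF T, of Z t t0] assms(1) that by blast
  moreover have "Z t0 = mat 1"
    using Y by (simp add: Z_def zero ts_fundamental_solution_def)
  moreover have "V (t - t0) ** Z t = Y t" for t
    by (simp add: Z_def matrix_mul_assoc zero flip: add)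
  ultimately have "Y t = V (t - t0)" if "t \<in> T" for t
    using that by (metis matrix_mul_rid)
  then show ?thesis using Y by (auto simp: ts_fundamental_solution_def)
qed

end

end

section \<open>Solution of the matrix exponential equation\<close>

theorem theorem3p5:
  fixes p t0 :: real and T :: "real set" and M :: "complex^'n^'n"
    and R :: "real \<Rightarrow> complex^'n^'n"
  assumes "p > 0" and "time_scale T" and "ts_periodic p T" and "t0 \<in> T" and "invertible M"
  defines "R \<equiv> floquet_matrix T p M"
  shows "(\<forall>t\<in>T. (exp_difference_quotient p M \<longlongrightarrow> R t) (at_right (ts_mu T t)))
    \<and> ts_regressive T R
    \<and> commutes_with_delta_integral T R
    \<and> (\<exists>!X. ts_fundamental_solution T R t0 X)
    \<and> ts_mat_exp T R (t0 + p) t0 = M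
    \<and> ((\<exists>c. \<forall>t\<in>{t0..t0 + p} \<inter> T. ts_mu T t = c) \<longrightarrow> R constant_on T)"
proof -
  have closed: "closed T" using assms(2) by (simp add: time_scale_def)
  have shift: "t + p \<in> T" if "t \<in> T" for t using assms(3) that by (simp add: ts_periodic_def)
  then have up: "\<forall>t\<in>T. \<exists>s\<in>T. t < s" using assms(1) by force
  define V where "V x = mat_rpower M (x / p)" for x
  have inner: "((\<lambda>x. x / p) has_vector_derivative 1 / p) (at 0)"
    by (auto intro!: derivative_eq_intros)
  have outer: "(mat_rpower M has_vector_derivative vector_derivative (mat_rpower M) (at 0)) (at (0 / p))"
    using mat_rpower_differentiable[OF assms(5)] by (simp add: vector_derivative_works)
  have deriv: "(V has_vector_derivative (1 / p) *\<^sub>R vector_derivative (mat_rpower M) (at 0)) (at 0)"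
    using vector_diff_chain_at[OF inner outer] by (simp add: V_def[abs_def] o_def)
  interpret V: one_parameter_group V "(1 / p) *\<^sub>R vector_derivative (mat_rpower M) (at 0)"
  proof
    show "V (x + y) = V x ** V y" for x y
      by (simp add: V_def add_divide_distrib mat_rpower_add[OF assms(5)])
    show "V 0 = mat 1"
      by (simp add: V_def mat_rpower_0[OF assms(5)])
  qed (rule deriv)
  have lim: "(exp_difference_quotient p M \<longlongrightarrow> V.quotient (ts_mu T t)) (at_right (ts_mu T t))" for t
  proof -
    \<comment> \<open>As \<open>T\<close> is unbounded above, this holds at every real
      \<open>t\<close>, so \<open>R\<close> can be identified as a total function. It confines the
      right-hand limit to positive \<open>s\<close>, where \<open>V.quotient\<close> is the plain
      difference quotient, also when the graininess is 0.\<close>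
    have "0 \<le> ts_mu T t"
      using graininess_bounds(1)[OF closed] unbounded_above[OF closed up] assms(4) by blast
    then have "\<forall>\<^sub>F s in at_right (ts_mu T t). V.quotient s = exp_difference_quotient p M s"
      by (auto simp: eventually_at_filter V.quotient_def exp_difference_quotient_def V_def intro!: always_eventually)
    moreover have "(V.quotient \<longlongrightarrow> V.quotient (ts_mu T t)) (at_right (ts_mu T t))"
      using V.continuous_quotient
      by (simp add: continuous_on_eq_continuous_at isCont_def filterlim_at_split)
    ultimately show ?thesis by (rule Lim_transform_eventually[rotated])
  qed
  have "R t = V.quotient (ts_mu T t)" for t
    unfolding R_def floquet_matrix_def using lim by (intro tendsto_Lim) auto
  then have R: "R = (\<lambda>t. V.quotient (ts_mu T t))" by auto
  let ?X = "\<lambda>t. if t \<in> T then V (t - t0) else 0"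
  have sol: "ts_fundamental_solution T R t0 X \<longleftrightarrow> X = ?X" for X
    unfolding R using V.fundamental_solution V.fundamental_solution_unique closed up assms(4) by blast
  have "ts_mat_exp T R (t0 + p) t0 = V p"
    \<comment> \<open>By \<open>sol\<close> the described predicate is equality with
      \<open>?X\<close>, and \<open>?X\<close> takes the value \<open>V p\<close> at
      \<open>t0 + p\<close>, a point of \<open>T\<close>.\<close>
    unfolding ts_mat_exp_def sol using shift assms(4) by simp
  also have "V p = M" using assms(1,5) by (simp add: V_def mat_rpower_1)
  finally have exp: "ts_mat_exp T R (t0 + p) t0 = M" .
  have const: "R constant_on T" if "\<forall>t\<in>{t0..t0 + p} \<inter> T. ts_mu T t = c" for c
    using ts_periodic_graininess_constant[OF assms(1) closed assms(3,4) that]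
    unfolding R constant_on_def by metis
  show ?thesis
  proof (intro conjI)
    show "\<forall>t\<in>T. (exp_difference_quotient p M \<longlongrightarrow> R t) (at_right (ts_mu T t))"
      using lim by (simp add: R)
    show "ts_regressive T R" "commutes_with_delta_integral T R"
      unfolding R using V.regressive V.commutes_with_integral closed up by auto
    show "\<exists>!X. ts_fundamental_solution T R t0 X"
      unfolding sol by simp
  qed (use exp const in blast)+
qed

end
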